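(* Let $M$ be a STCR lightlike submanifold of an indefinite Kähler manifold $\bar M$. Then $D$ defines a totally geodesic foliation on $\bar M$ if and only if $M$ is $D$-geodesic.
   Context: Indefinite Kähler manifold $(\bar M,\bar J,\bar g)$: a semi-Riemannian manifold of constant index $q$, $0<q<\dim\bar M$, with an almost complex structure $\bar J$ ($\bar J^2=-I$) satisfying $\bar g(\bar JX,\bar JY)=\bar g(X,Y)$ and $\bar\nabla\bar J=0$, where $\bar\nabla$ is the Levi-Civita connection of $\bar g$. Lightlike submanifold: a submanifold $M$ of dimension $m$ of $\bar M$ (of dimension $m+n$), with induced metric $g$, such that $Rad(TM)=TM\cap TM^\perp$ has constant rank $r$, $1\le r\le m$. One fixes non-degenerate complements: a screen distribution $S(TM)$ with $TM=S(TM)\perp Rad(TM)$ and a screen transversal bundle $S(TM^\perp)$ with $TM^\perp=S(TM^\perp)\perp Rad(TM)$. The lightlike transversal bundle $ltr(TM)$ is a rank $r$ complement of $Rad(TM)$ in the orthogonal complement of $S(TM)\perp S(TM^\perp)$ in $T\bar M|_M$, locally spanned by $N_1,\dots,N_r$ with $\bar g(\xi_i,N_j)=\delta_{ij}$, $\bar g(N_i,N_j)=0$ for a local basis $\{\xi_i\}$ of $Rad(TM)$. Put $tr(TM)=ltr(TM)\perp S(TM^\perp)$; then $T\bar M|_M=TM\oplus tr(TM)$. STCR (screen transversal Cauchy Riemann) lightlike submanifold: a real lightlike submanifold $M$ of $\bar M$ such that (A) there are subbundles $D_1,D_2$ of $Rad(TM)$ with $Rad(TM)=D_1\oplus D_2$,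 $\bar J(D_1)\subset S(TM)$, $\bar J(D_2)\subset S(TM^\perp)$; (B) there are subbundles $D_0,D'$ of $S(TM)$ with $S(TM)=\{\bar JD_1\oplus D'\}\perp D_0$, $\bar J(D_0)=D_0$, $\bar J(D')=L_1\perp S$, where $D_0$ is non-degenerate and $L_1$, $S$ are vector subbundles of $ltr(TM)$ and $S(TM^\perp)$ respectively. Moreover $ltr(TM)=L_1\oplus L_2$ with $\bar J(L_1)\subset S(TM)$, $\bar J(L_2)\subset S(TM^\perp)$, and $S(TM^\perp)=\{\bar J(D_2)\oplus\bar J(L_2)\}\perp S$. Then $TM=D\oplus\tilde D$, where $D=D_0\oplus D_1\oplus\bar JD_1$ is $\bar J$-invariant and $\tilde D=D_2\oplus\bar JL_1\oplus\bar JS$ satisfies $\bar J\tilde D\subset tr(TM)$. Gauss formula: $\bar\nabla_XY=\nabla_XY+h(X,Y)$ for $X,Y\in\Gamma(TM)$, with $\nabla_XY\in\Gamma(TM)$, $h(X,Y)\in\Gamma(tr(TM))$. $M$ is $D$-geodesic if $h(X,Y)=0$ for all $X,Y\in\Gamma(D)$. $D$ defines a totally geodesic foliation on $\bar M$ if $\bar\nabla_XY\in\Gamma(D)$ for all $X,Y\in\Gamma(D)$. *)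

theory Defs
  imports "HOL-Analysis.Analysis" "HOL-Library.Function_Algebras" "HOL-Library.Set_Algebras"
begin

section \<open>Smooth manifolds\<close>

text \<open>The sets \<open>S\<close> below are always open.\<close>

primrec Ck_on :: "nat \<Rightarrow> 'e::euclidean_space set \<Rightarrow> ('e \<Rightarrow> 'f::real_normed_vector) \<Rightarrow> bool" where
  "Ck_on 0 S \<phi> \<longleftrightarrow> continuous_on S \<phi>"
| "Ck_on (Suc k) S \<phi> \<longleftrightarrow> (\<forall>x\<in>S. \<phi> differentiable (at x)) \<and>
     (\<forall>v. Ck_on k S (\<lambda>x. frechet_derivative \<phi> (at x) v))"

definition smooth_on :: "'e::euclidean_space set \<Rightarrow> ('e \<Rightarrow> 'f::real_normed_vector) \<Rightarrow> bool" where
  "smooth_on S \<phi> \<longleftrightarrow> (\<forall>k. Ck_on k S \<phi>)"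

text \<open>The manifold is the whole type \<open>'a\<close>, its dimension is \<open>DIM('e)\<close>, and a chart is a pair
  of a domain and a coordinate map.\<close>

type_synonym ('a, 'e) atlas = "('a set \<times> ('a \<Rightarrow> 'e)) set"

definition smooth_manifold ::
  "('a::{t2_space,second_countable_topology}, 'e::euclidean_space) atlas \<Rightarrow> bool" where
  "smooth_manifold A \<longleftrightarrow>
     (\<Union>(U, x)\<in>A. U) = UNIV \<and>
     (\<forall>(U, x)\<in>A. open U \<and> open (x ` U) \<and> homeomorphism U (x ` U) x (inv_into U x)) \<and>
     (\<forall>(U, x)\<in>A. \<forall>(V, y)\<in>A. smooth_on (x ` (U \<inter> V)) (y \<circ> inv_into U x))"

definition smooth_map ::
  "('b::topological_space, 'd::euclidean_space) atlas \<Rightarrow>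
   ('a::topological_space, 'e::euclidean_space) atlas \<Rightarrow> ('b \<Rightarrow> 'a) \<Rightarrow> bool" where
  "smooth_map B A f \<longleftrightarrow> continuous_on UNIV f \<and>
     (\<forall>(U, x)\<in>B. \<forall>(V, y)\<in>A. smooth_on (x ` (U \<inter> f -` V)) (y \<circ> f \<circ> inv_into U x))"

definition smooth_fun ::
  "('a::topological_space, 'e::euclidean_space) atlas \<Rightarrow> 'a set \<Rightarrow> ('a \<Rightarrow> real) \<Rightarrow> bool" where
  "smooth_fun A U \<phi> \<longleftrightarrow> open U \<and> (\<forall>(V, x)\<in>A. smooth_on (x ` (U \<inter> V)) (\<phi> \<circ> inv_into V x))"

definition smooth_near ::
  "('a::topological_space, 'e::euclidean_space) atlas \<Rightarrow> 'a \<Rightarrow> ('a \<Rightarrow> real) \<Rightarrow> bool" where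
  "smooth_near A p \<phi> \<longleftrightarrow> (\<exists>U. p \<in> U \<and> smooth_fun A U \<phi>)"


section \<open>Tangent vectors and vector fields\<close>

text \<open>Tangent vectors are derivations of germs of smooth functions; functionals on
  \<open>'a \<Rightarrow> real\<close> form a real vector space under the pointwise operations.\<close>

instantiation "fun" :: (type, real_vector) real_vector
begin

definition scaleR_fun :: "real \<Rightarrow> ('a \<Rightarrow> 'b) \<Rightarrow> 'a \<Rightarrow> 'b" where
  "scaleR_fun c \<phi> = (\<lambda>x. c *\<^sub>R \<phi> x)"

instance
  by standard (simp_all add: scaleR_fun_def fun_eq_iff plus_fun_def scaleR_add_right scaleR_add_left)

end

type_synonym 'a tvec = "('a \<Rightarrow> real) \<Rightarrow> real"

text \<open>The first clause is a normalisation, so that a derivation is determined by its values on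
  functions smooth near \<open>p\<close>. That it depends on germs only follows from the product rule, applied
  to \<open>\<phi> * \<chi>\<close> with \<open>\<chi>\<close> the indicator function of the complement of a neighbourhood of \<open>p\<close>.\<close>

definition tangent_space ::
  "('a::topological_space, 'e::euclidean_space) atlas \<Rightarrow> 'a \<Rightarrow> 'a tvec set" where
  "tangent_space A p = {v.
     (\<forall>\<phi>. \<not> smooth_near A p \<phi> \<longrightarrow> v \<phi> = 0) \<and>
     (\<forall>\<phi> \<psi>. smooth_near A p \<phi> \<longrightarrow> smooth_near A p \<psi> \<longrightarrow> v (\<phi> + \<psi>) = v \<phi> + v \<psi>) \<and>
     (\<forall>c \<phi>. smooth_near A p \<phi> \<longrightarrow> v (c *\<^sub>R \<phi>) = c * v \<phi>) \<and>
     (\<forall>\<phi> \<psi>. smooth_near A p \<phi> \<longrightarrow> smooth_near A p \<psi> \<longrightarrow>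
        v (\<phi> * \<psi>) = \<phi> p * v \<psi> + \<psi> p * v \<phi>)}"

definition pushforward ::
  "('a::topological_space, 'e::euclidean_space) atlas \<Rightarrow> ('b \<Rightarrow> 'a) \<Rightarrow> 'b \<Rightarrow> 'b tvec \<Rightarrow> 'a tvec" where
  "pushforward A f p v = (\<lambda>\<psi>. if smooth_near A (f p) \<psi> then v (\<psi> \<circ> f) else 0)"

definition vector_field ::
  "('a::topological_space, 'e::euclidean_space) atlas \<Rightarrow> 'a set \<Rightarrow> ('a \<Rightarrow> 'a tvec) \<Rightarrow> bool" where
  "vector_field A U X \<longleftrightarrow> open U \<and> (\<forall>p\<in>U. X p \<in> tangent_space A p) \<and>
     (\<forall>V \<phi>. V \<subseteq> U \<longrightarrow> smooth_fun A V \<phi> \<longrightarrow> smooth_fun A V (\<lambda>p. X p \<phi>))"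

definition lie_bracket ::
  "('a::topological_space, 'e::euclidean_space) atlas \<Rightarrow>
   ('a \<Rightarrow> 'a tvec) \<Rightarrow> ('a \<Rightarrow> 'a tvec) \<Rightarrow> 'a \<Rightarrow> 'a tvec" where
  "lie_bracket A X Y p =
     (\<lambda>\<phi>. if smooth_near A p \<phi> then X p (\<lambda>q. Y q \<phi>) - Y p (\<lambda>q. X q \<phi>) else 0)"


section \<open>Semi-Riemannian metrics and the Levi-Civita connection\<close>

definition nondegenerate_on :: "('v \<Rightarrow> 'v \<Rightarrow> real) \<Rightarrow> 'v::zero set \<Rightarrow> bool" where
  "nondegenerate_on b E \<longleftrightarrow> (\<forall>u\<in>E. (\<forall>v\<in>E. b u v = 0) \<longrightarrow> u = 0)"

definition negative_definite_on :: "('v \<Rightarrow> 'v \<Rightarrow> real) \<Rightarrow> 'v::zero set \<Rightarrow> bool" where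
  "negative_definite_on b E \<longleftrightarrow> (\<forall>u\<in>E. u \<noteq> 0 \<longrightarrow> b u u < 0)"

definition semi_riemannian_metric ::
  "('a::topological_space, 'e::euclidean_space) atlas \<Rightarrow> nat \<Rightarrow>
   ('a \<Rightarrow> 'a tvec \<Rightarrow> 'a tvec \<Rightarrow> real) \<Rightarrow> bool" where
  "semi_riemannian_metric A q g \<longleftrightarrow>
     (\<forall>p. \<forall>u\<in>tangent_space A p. \<forall>v\<in>tangent_space A p. \<forall>w\<in>tangent_space A p. \<forall>a b.
        g p (a *\<^sub>R u + b *\<^sub>R v) w = a * g p u w + b * g p v w) \<and>
     (\<forall>p. \<forall>u\<in>tangent_space A p. \<forall>v\<in>tangent_space A p. g p u v = g p v u) \<and>
     (\<forall>p. nondegenerate_on (g p) (tangent_space A p)) \<and>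
     (\<forall>p. (\<exists>E. subspace E \<and> E \<subseteq> tangent_space A p \<and> negative_definite_on (g p) E \<and> dim E = q) \<and>
          (\<forall>E. subspace E \<and> E \<subseteq> tangent_space A p \<and> negative_definite_on (g p) E \<longrightarrow> dim E \<le> q)) \<and>
     (\<forall>U X Y. vector_field A U X \<longrightarrow> vector_field A U Y \<longrightarrow> smooth_fun A U (\<lambda>p. g p (X p) (Y p)))"

text \<open>A connection acts on vector fields defined on arbitrary open sets. Since the fields are total
  functions that need to be smooth on \<open>U\<close> only, linearity over the functions smooth on \<open>U\<close> and the
  product rule already make \<open>nabla\<close> a local operator: use functions that vanish on \<open>U\<close>.\<close>

definition affine_connection ::
  "('a::topological_space, 'e::euclidean_space) atlas \<Rightarrow>
   (('a \<Rightarrow> 'a tvec) \<Rightarrow> ('a \<Rightarrow> 'a tvec) \<Rightarrow> 'a \<Rightarrow> 'a tvec) \<Rightarrow> bool" where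
  "affine_connection A nabla \<longleftrightarrow>
     (\<forall>U X Y. vector_field A U X \<longrightarrow> vector_field A U Y \<longrightarrow> vector_field A U (nabla X Y)) \<and>
     (\<forall>U X X' Y. vector_field A U X \<longrightarrow> vector_field A U X' \<longrightarrow> vector_field A U Y \<longrightarrow>
        (\<forall>p\<in>U. nabla (X + X') Y p = nabla X Y p + nabla X' Y p)) \<and>
     (\<forall>U \<phi> X Y. smooth_fun A U \<phi> \<longrightarrow> vector_field A U X \<longrightarrow> vector_field A U Y \<longrightarrow>
        (\<forall>p\<in>U. nabla (\<lambda>q. \<phi> q *\<^sub>R X q) Y p = \<phi> p *\<^sub>R nabla X Y p)) \<and>
     (\<forall>U X Y Y'. vector_field A U X \<longrightarrow> vector_field A U Y \<longrightarrow> vector_field A U Y' \<longrightarrow>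
        (\<forall>p\<in>U. nabla X (Y + Y') p = nabla X Y p + nabla X Y' p)) \<and>
     (\<forall>U \<phi> X Y. smooth_fun A U \<phi> \<longrightarrow> vector_field A U X \<longrightarrow> vector_field A U Y \<longrightarrow>
        (\<forall>p\<in>U. nabla X (\<lambda>q. \<phi> q *\<^sub>R Y q) p = X p \<phi> *\<^sub>R Y p + \<phi> p *\<^sub>R nabla X Y p))"

definition levi_civita_connection ::
  "('a::topological_space, 'e::euclidean_space) atlas \<Rightarrow> ('a \<Rightarrow> 'a tvec \<Rightarrow> 'a tvec \<Rightarrow> real) \<Rightarrow>
   (('a \<Rightarrow> 'a tvec) \<Rightarrow> ('a \<Rightarrow> 'a tvec) \<Rightarrow> 'a \<Rightarrow> 'a tvec) \<Rightarrow> bool" where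
  "levi_civita_connection A g nabla \<longleftrightarrow> affine_connection A nabla \<and>
     (\<forall>U X Y. vector_field A U X \<longrightarrow> vector_field A U Y \<longrightarrow>
        (\<forall>p\<in>U. nabla X Y p - nabla Y X p = lie_bracket A X Y p)) \<and>
     (\<forall>U X Y Z. vector_field A U X \<longrightarrow> vector_field A U Y \<longrightarrow> vector_field A U Z \<longrightarrow>
        (\<forall>p\<in>U. X p (\<lambda>q. g q (Y q) (Z q)) = g p (nabla X Y p) (Z p) + g p (Y p) (nabla X Z p)))"


section \<open>Indefinite Kaehler manifolds\<close>

definition almost_complex_structure ::
  "('a::topological_space, 'e::euclidean_space) atlas \<Rightarrow> ('a \<Rightarrow> 'a tvec \<Rightarrow> 'a tvec) \<Rightarrow> bool" where
  "almost_complex_structure A J \<longleftrightarrow>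
     (\<forall>p. \<forall>v\<in>tangent_space A p. J p v \<in> tangent_space A p \<and> J p (J p v) = - v) \<and>
     (\<forall>p. \<forall>u\<in>tangent_space A p. \<forall>v\<in>tangent_space A p. \<forall>a b.
        J p (a *\<^sub>R u + b *\<^sub>R v) = a *\<^sub>R J p u + b *\<^sub>R J p v) \<and>
     (\<forall>U X. vector_field A U X \<longrightarrow> vector_field A U (\<lambda>p. J p (X p)))"

definition indefinite_kaehler_manifold ::
  "('a::{t2_space,second_countable_topology}, 'e::euclidean_space) atlas \<Rightarrow> nat \<Rightarrow>
   ('a \<Rightarrow> 'a tvec \<Rightarrow> 'a tvec \<Rightarrow> real) \<Rightarrow> ('a \<Rightarrow> 'a tvec \<Rightarrow> 'a tvec) \<Rightarrow>
   (('a \<Rightarrow> 'a tvec) \<Rightarrow> ('a \<Rightarrow> 'a tvec) \<Rightarrow> 'a \<Rightarrow> 'a tvec) \<Rightarrow> bool" where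
  "indefinite_kaehler_manifold A q g J nabla \<longleftrightarrow>
     smooth_manifold A \<and> 0 < q \<and> q < DIM('e) \<and>
     semi_riemannian_metric A q g \<and> almost_complex_structure A J \<and>
     (\<forall>p. \<forall>u\<in>tangent_space A p. \<forall>v\<in>tangent_space A p. g p (J p u) (J p v) = g p u v) \<and>
     levi_civita_connection A g nabla \<and>
     (\<forall>U X Y. vector_field A U X \<longrightarrow> vector_field A U Y \<longrightarrow>
        (\<forall>p\<in>U. nabla X (\<lambda>q. J q (Y q)) p = J p (nabla X Y p)))"


section \<open>Submanifolds and vector bundles along them\<close>

text \<open>A submanifold is given by an injective immersion \<open>f\<close>.\<close>

definition submanifold ::
  "('a::topological_space, 'e::euclidean_space) atlas \<Rightarrow>
   ('b::{t2_space,second_countable_topology}, 'd::euclidean_space) atlas \<Rightarrow> ('b \<Rightarrow> 'a) \<Rightarrow> bool" where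
  "submanifold A B f \<longleftrightarrow> smooth_manifold B \<and> smooth_map B A f \<and> inj f \<and>
     (\<forall>p. inj_on (pushforward A f p) (tangent_space B p))"

text \<open>Smooth sections over the open set \<open>W\<close> of the ambient tangent bundle restricted to the
  submanifold: fields along \<open>f\<close> that extend, locally, to vector fields of the ambient manifold
  (as \<open>f\<close> is an immersion, these are the fields with smooth components).\<close>

definition section_along ::
  "('a::topological_space, 'e::euclidean_space) atlas \<Rightarrow> ('b::topological_space \<Rightarrow> 'a) \<Rightarrow>
   'b set \<Rightarrow> ('b \<Rightarrow> 'a tvec) \<Rightarrow> bool" where
  "section_along A f W Y \<longleftrightarrow> open W \<and>
     (\<forall>p\<in>W. \<exists>V U Y'. open V \<and> p \<in> V \<and> V \<subseteq> W \<and> f ` V \<subseteq> U \<and> vector_field A U Y' \<and>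
        (\<forall>q\<in>V. Y q = Y' (f q)))"

definition local_frame ::
  "('a::topological_space, 'e::euclidean_space) atlas \<Rightarrow> ('b::topological_space \<Rightarrow> 'a) \<Rightarrow>
   nat \<Rightarrow> ('b \<Rightarrow> 'a tvec set) \<Rightarrow> 'b set \<Rightarrow> (nat \<Rightarrow> 'b \<Rightarrow> 'a tvec) \<Rightarrow> bool" where
  "local_frame A f k E W s \<longleftrightarrow> (\<forall>i<k. section_along A f W (s i)) \<and>
     (\<forall>p\<in>W. inj_on (\<lambda>i. s i p) {..<k} \<and> independent ((\<lambda>i. s i p) ` {..<k}) \<and>
        span ((\<lambda>i. s i p) ` {..<k}) = E p)"

definition vector_subbundle ::
  "('a::topological_space, 'e::euclidean_space) atlas \<Rightarrow> ('b::topological_space \<Rightarrow> 'a) \<Rightarrow>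
   ('b \<Rightarrow> 'a tvec set) \<Rightarrow> bool" where
  "vector_subbundle A f E \<longleftrightarrow> (\<exists>k. \<forall>p. \<exists>W s. open W \<and> p \<in> W \<and> local_frame A f k E W s)"

definition subbundle_of ::
  "('a::topological_space, 'e::euclidean_space) atlas \<Rightarrow> ('b::topological_space \<Rightarrow> 'a) \<Rightarrow>
   ('b \<Rightarrow> 'a tvec set) \<Rightarrow> ('b \<Rightarrow> 'a tvec set) \<Rightarrow> bool" where
  "subbundle_of A f F E \<longleftrightarrow> vector_subbundle A f F \<and> (\<forall>p. F p \<subseteq> E p)"

definition smooth_sections ::
  "('a::topological_space, 'e::euclidean_space) atlas \<Rightarrow> ('b::topological_space \<Rightarrow> 'a) \<Rightarrow>
   ('b \<Rightarrow> 'a tvec set) \<Rightarrow> ('b \<Rightarrow> 'a tvec) set" where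
  "smooth_sections A f E = {X. section_along A f UNIV X \<and> (\<forall>p. X p \<in> E p)}"

text \<open>The ambient covariant derivative of a field \<open>Y\<close> along \<open>f\<close> in the direction of a field \<open>X\<close>
  tangent to the submanifold, by local extension of \<open>X\<close> and \<open>Y\<close>. The value does not depend on
  the extensions.\<close>

definition cov_along ::
  "('a::topological_space, 'e::euclidean_space) atlas \<Rightarrow> ('b::topological_space \<Rightarrow> 'a) \<Rightarrow>
   (('a \<Rightarrow> 'a tvec) \<Rightarrow> ('a \<Rightarrow> 'a tvec) \<Rightarrow> 'a \<Rightarrow> 'a tvec) \<Rightarrow>
   ('b \<Rightarrow> 'a tvec) \<Rightarrow> ('b \<Rightarrow> 'a tvec) \<Rightarrow> 'b \<Rightarrow> 'a tvec" where
  "cov_along A f nabla X Y p = (THE w. \<exists>V U X' Y'. open V \<and> p \<in> V \<and> f ` V \<subseteq> U \<and>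
     vector_field A U X' \<and> vector_field A U Y' \<and>
     (\<forall>q\<in>V. X' (f q) = X q \<and> Y' (f q) = Y q) \<and> w = nabla X' Y' (f p))"

definition tangent_bundle ::
  "('a::topological_space, 'e::euclidean_space) atlas \<Rightarrow>
   ('b::topological_space, 'd::euclidean_space) atlas \<Rightarrow> ('b \<Rightarrow> 'a) \<Rightarrow> 'b \<Rightarrow> 'a tvec set" where
  "tangent_bundle A B f p = pushforward A f p ` tangent_space B p"

definition normal_bundle ::
  "('a::topological_space, 'e::euclidean_space) atlas \<Rightarrow> ('a \<Rightarrow> 'a tvec \<Rightarrow> 'a tvec \<Rightarrow> real) \<Rightarrow>
   ('b::topological_space, 'd::euclidean_space) atlas \<Rightarrow> ('b \<Rightarrow> 'a) \<Rightarrow> 'b \<Rightarrow> 'a tvec set" where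
  "normal_bundle A g B f p =
     {v \<in> tangent_space A (f p). \<forall>w\<in>tangent_bundle A B f p. g (f p) v w = 0}"

definition radical ::
  "('a::topological_space, 'e::euclidean_space) atlas \<Rightarrow> ('a \<Rightarrow> 'a tvec \<Rightarrow> 'a tvec \<Rightarrow> real) \<Rightarrow>
   ('b::topological_space, 'd::euclidean_space) atlas \<Rightarrow> ('b \<Rightarrow> 'a) \<Rightarrow> 'b \<Rightarrow> 'a tvec set" where
  "radical A g B f p = tangent_bundle A B f p \<inter> normal_bundle A g B f p"


section \<open>Lightlike and STCR lightlike submanifolds\<close>

definition direct_sum :: "'v::ab_group_add set \<Rightarrow> 'v set \<Rightarrow> 'v set \<Rightarrow> bool" where
  "direct_sum E F G \<longleftrightarrow> E = F + G \<and> F \<inter> G = {0}"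

definition orth_direct_sum ::
  "('v \<Rightarrow> 'v \<Rightarrow> real) \<Rightarrow> 'v::ab_group_add set \<Rightarrow> 'v set \<Rightarrow> 'v set \<Rightarrow> bool" where
  "orth_direct_sum b E F G \<longleftrightarrow> direct_sum E F G \<and> (\<forall>u\<in>F. \<forall>v\<in>G. b u v = 0)"

text \<open>\<open>ST\<close>, \<open>STp\<close> and \<open>ltr\<close> are the screen distribution, the screen transversal bundle and the
  lightlike transversal bundle.\<close>

definition lightlike_submanifold ::
  "('a::topological_space, 'e::euclidean_space) atlas \<Rightarrow> ('a \<Rightarrow> 'a tvec \<Rightarrow> 'a tvec \<Rightarrow> real) \<Rightarrow>
   ('b::{t2_space,second_countable_topology}, 'd::euclidean_space) atlas \<Rightarrow> ('b \<Rightarrow> 'a) \<Rightarrow> nat \<Rightarrow>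
   ('b \<Rightarrow> 'a tvec set) \<Rightarrow> ('b \<Rightarrow> 'a tvec set) \<Rightarrow> ('b \<Rightarrow> 'a tvec set) \<Rightarrow> bool" where
  "lightlike_submanifold A g B f r ST STp ltr \<longleftrightarrow>
     submanifold A B f \<and> 1 \<le> r \<and> r \<le> DIM('d) \<and>
     (\<forall>p. dim (radical A g B f p) = r) \<and>
     vector_subbundle A f ST \<and>
     (\<forall>p. orth_direct_sum (g (f p)) (tangent_bundle A B f p) (ST p) (radical A g B f p) \<and>
          nondegenerate_on (g (f p)) (ST p)) \<and>
     vector_subbundle A f STp \<and>
     (\<forall>p. orth_direct_sum (g (f p)) (normal_bundle A g B f p) (STp p) (radical A g B f p) \<and>
          nondegenerate_on (g (f p)) (STp p)) \<and>
     (\<forall>p. direct_sum {v \<in> tangent_space A (f p). \<forall>w\<in>ST p + STp p. g (f p) v w = 0}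
            (radical A g B f p) (ltr p)) \<and>
     (\<forall>p. \<exists>W \<xi> N. open W \<and> p \<in> W \<and>
        local_frame A f r (radical A g B f) W \<xi> \<and> local_frame A f r ltr W N \<and>
        (\<forall>q\<in>W. \<forall>i<r. \<forall>j<r. g (f q) (\<xi> i q) (N j q) = (if i = j then 1 else 0) \<and>
           g (f q) (N i q) (N j q) = 0))"

definition transversal_bundle ::
  "('b \<Rightarrow> 'a tvec set) \<Rightarrow> ('b \<Rightarrow> 'a tvec set) \<Rightarrow> 'b \<Rightarrow> 'a tvec set" where
  "transversal_bundle STp ltr p = ltr p + STp p"

text \<open>\<open>D'\<close> is written \<open>Dp\<close>.\<close>

definition stcr_lightlike_submanifold ::
  "('a::topological_space, 'e::euclidean_space) atlas \<Rightarrow> ('a \<Rightarrow> 'a tvec \<Rightarrow> 'a tvec \<Rightarrow> real) \<Rightarrow>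
   ('a \<Rightarrow> 'a tvec \<Rightarrow> 'a tvec) \<Rightarrow>
   ('b::{t2_space,second_countable_topology}, 'd::euclidean_space) atlas \<Rightarrow> ('b \<Rightarrow> 'a) \<Rightarrow> nat \<Rightarrow>
   ('b \<Rightarrow> 'a tvec set) \<Rightarrow> ('b \<Rightarrow> 'a tvec set) \<Rightarrow> ('b \<Rightarrow> 'a tvec set) \<Rightarrow>
   ('b \<Rightarrow> 'a tvec set) \<Rightarrow> ('b \<Rightarrow> 'a tvec set) \<Rightarrow> ('b \<Rightarrow> 'a tvec set) \<Rightarrow> ('b \<Rightarrow> 'a tvec set) \<Rightarrow>
   ('b \<Rightarrow> 'a tvec set) \<Rightarrow> ('b \<Rightarrow> 'a tvec set) \<Rightarrow> ('b \<Rightarrow> 'a tvec set) \<Rightarrow> bool" where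
  "stcr_lightlike_submanifold A g J B f r ST STp ltr D0 D1 D2 Dp L1 L2 S \<longleftrightarrow>
     lightlike_submanifold A g B f r ST STp ltr \<and>
     subbundle_of A f D1 (radical A g B f) \<and> subbundle_of A f D2 (radical A g B f) \<and>
     (\<forall>p. direct_sum (radical A g B f p) (D1 p) (D2 p) \<and>
          J (f p) ` D1 p \<subseteq> ST p \<and> J (f p) ` D2 p \<subseteq> STp p) \<and>
     subbundle_of A f D0 ST \<and> subbundle_of A f Dp ST \<and>
     subbundle_of A f L1 ltr \<and> subbundle_of A f S STp \<and>
     (\<forall>p. direct_sum (J (f p) ` D1 p + Dp p) (J (f p) ` D1 p) (Dp p) \<and>
          orth_direct_sum (g (f p)) (ST p) (J (f p) ` D1 p + Dp p) (D0 p) \<and>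
          J (f p) ` D0 p = D0 p \<and> nondegenerate_on (g (f p)) (D0 p) \<and>
          orth_direct_sum (g (f p)) (J (f p) ` Dp p) (L1 p) (S p)) \<and>
     subbundle_of A f L2 ltr \<and>
     (\<forall>p. direct_sum (ltr p) (L1 p) (L2 p) \<and>
          J (f p) ` L1 p \<subseteq> ST p \<and> J (f p) ` L2 p \<subseteq> STp p \<and>
          direct_sum (J (f p) ` D2 p + J (f p) ` L2 p) (J (f p) ` D2 p) (J (f p) ` L2 p) \<and>
          orth_direct_sum (g (f p)) (STp p) (J (f p) ` D2 p + J (f p) ` L2 p) (S p))"

definition stcr_distribution ::
  "('a \<Rightarrow> 'a tvec \<Rightarrow> 'a tvec) \<Rightarrow> ('b \<Rightarrow> 'a) \<Rightarrow> ('b \<Rightarrow> 'a tvec set) \<Rightarrow> ('b \<Rightarrow> 'a tvec set) \<Rightarrow>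
   'b \<Rightarrow> 'a tvec set" where
  "stcr_distribution J f D0 D1 p = D0 p + D1 p + J (f p) ` D1 p"


section \<open>Gauss formula\<close>

text \<open>\<open>h(X, Y)\<close> is the component of the ambient covariant derivative in the transversal bundle \<open>tr\<close>
  with respect to the decomposition of the ambient tangent bundle along the submanifold as the
  direct sum of the tangent bundle \<open>TM\<close> and \<open>tr\<close>.\<close>

definition second_fundamental_form ::
  "('a::topological_space, 'e::euclidean_space) atlas \<Rightarrow>
   (('a \<Rightarrow> 'a tvec) \<Rightarrow> ('a \<Rightarrow> 'a tvec) \<Rightarrow> 'a \<Rightarrow> 'a tvec) \<Rightarrow>
   ('b::topological_space, 'd::euclidean_space) atlas \<Rightarrow> ('b \<Rightarrow> 'a) \<Rightarrow> ('b \<Rightarrow> 'a tvec set) \<Rightarrow>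
   ('b \<Rightarrow> 'a tvec) \<Rightarrow> ('b \<Rightarrow> 'a tvec) \<Rightarrow> 'b \<Rightarrow> 'a tvec" where
  "second_fundamental_form A nabla B f tr X Y p =
     (THE t. t \<in> tr p \<and> (\<exists>u\<in>tangent_bundle A B f p. cov_along A f nabla X Y p = u + t))"

definition geodesic_wrt ::
  "('a::topological_space, 'e::euclidean_space) atlas \<Rightarrow>
   (('a \<Rightarrow> 'a tvec) \<Rightarrow> ('a \<Rightarrow> 'a tvec) \<Rightarrow> 'a \<Rightarrow> 'a tvec) \<Rightarrow>
   ('b::topological_space, 'd::euclidean_space) atlas \<Rightarrow> ('b \<Rightarrow> 'a) \<Rightarrow> ('b \<Rightarrow> 'a tvec set) \<Rightarrow>
   ('b \<Rightarrow> 'a tvec set) \<Rightarrow> bool" where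
  "geodesic_wrt A nabla B f tr D \<longleftrightarrow>
     (\<forall>X\<in>smooth_sections A f D. \<forall>Y\<in>smooth_sections A f D.
        \<forall>p. second_fundamental_form A nabla B f tr X Y p = 0)"

definition totally_geodesic_foliation ::
  "('a::topological_space, 'e::euclidean_space) atlas \<Rightarrow>
   (('a \<Rightarrow> 'a tvec) \<Rightarrow> ('a \<Rightarrow> 'a tvec) \<Rightarrow> 'a \<Rightarrow> 'a tvec) \<Rightarrow>
   ('b::topological_space \<Rightarrow> 'a) \<Rightarrow> ('b \<Rightarrow> 'a tvec set) \<Rightarrow> bool" where
  "totally_geodesic_foliation A nabla f D \<longleftrightarrow>
     (\<forall>X\<in>smooth_sections A f D. \<forall>Y\<in>smooth_sections A f D.
        cov_along A f nabla X Y \<in> smooth_sections A f D)"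

end

theory Submission
  imports Defs
begin

text \<open>If \<open>\<nabla>\<^sub>X Y\<close> lies in \<open>D \<subseteq> TM\<close>, its transversal part vanishes. Conversely, if \<open>M\<close> is
  \<open>D\<close>-geodesic and \<open>X\<close>, \<open>Y\<close> are sections of the \<open>J\<close>-invariant bundle \<open>D\<close>, then both \<open>\<nabla>\<^sub>X Y\<close>
  and \<open>J (\<nabla>\<^sub>X Y) = \<nabla>\<^sub>X (J Y)\<close> are tangent to \<open>M\<close>; writing \<open>TM = D + (D\<^sub>2 + D')\<close> with
  \<open>J (D\<^sub>2 + D') \<subseteq> tr(TM)\<close> and \<open>TM \<inter> tr(TM) = 0\<close>, the \<open>(D\<^sub>2 + D')\<close>-part of \<open>\<nabla>\<^sub>X Y\<close> vanishes.

  The covariant derivative along \<open>f\<close> is independent of the extensions because of metric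
  compatibility (in the second argument) and vanishing torsion (in the first); this uses that
  both fields are tangent to \<open>M\<close>. Test fields with enough values at a point come from extending
  the frames of the four summands of the ambient tangent bundle along \<open>M\<close>.\<close>

section \<open>Locality of derivations\<close>

text \<open>Openness of \<open>S'\<close> makes the Frechet derivatives agree at each of its points,
  so the induction passes from the two functions to their directional derivatives; hence both
  functions are generalised.\<close>

lemma Ck_on_cong_open:
  assumes "open S'" "S' \<subseteq> S" "\<And>x. x \<in> S' \<Longrightarrow> \<phi> x = \<psi> x" "Ck_on k S \<phi>"
  shows "Ck_on k S' \<psi>"
  using assms(3,4)
proof (induction k arbitrary: \<phi> \<psi>)
  case 0
  then show ?case
    using assms(2) by (metis Ck_on.simps(1) continuous_on_cong continuous_on_subset)
next
  case (Suc k)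
  have der: "(\<psi> has_derivative frechet_derivative \<phi> (at x)) (at x)" if "x \<in> S'" for x
  proof -
    have "(\<phi> has_derivative frechet_derivative \<phi> (at x)) (at x)"
      using Suc.prems(2) assms(2) that by (auto simp: frechet_derivative_works)
    then show ?thesis
      by (rule has_derivative_transform_within_open[OF _ assms(1) that]) (use Suc.prems(1) in auto)
  qed
  have "frechet_derivative \<psi> (at x) = frechet_derivative \<phi> (at x)" if "x \<in> S'" for x
    using frechet_derivative_at[OF der[OF that]] by simp
  then have "Ck_on k S' (\<lambda>x. frechet_derivative \<psi> (at x) v)" for v
    using Suc.IH[of "\<lambda>x. frechet_derivative \<phi> (at x) v"] Suc.prems(2) by auto
  then show ?case
    using der by (auto simp: differentiable_def)
qed

lemma smooth_on_cong_open:
  assumes "open S'" "S' \<subseteq> S" "\<And>x. x \<in> S' \<Longrightarrow> \<phi> x = \<psi> x" "smooth_on S \<phi>"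
  shows "smooth_on S' \<psi>"
  using assms Ck_on_cong_open unfolding smooth_on_def by metis

lemma smooth_on_zero: "smooth_on S (\<lambda>_::'e::euclidean_space. 0::'f::real_normed_vector)"
proof -
  have "Ck_on k S (\<lambda>_::'e. 0::'f)" for k
    by (induction k) auto
  then show ?thesis
    by (simp add: smooth_on_def)
qed

text \<open>The last claim turns open sets of the manifold into open sets of coordinates, where
  agreeing functions share their smoothness.\<close>

lemma smooth_manifold_chart:
  assumes "smooth_manifold A" "(W, x) \<in> A"
  shows "open W" "\<And>w. w \<in> W \<Longrightarrow> inv_into W x (x w) = w"
    and "\<And>U. open U \<Longrightarrow> open (x ` (U \<inter> W))"
proof -
  have W: "open W" "open (x ` W)" "homeomorphism W (x ` W) x (inv_into W x)"
    using assms by (auto simp: smooth_manifold_def)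
  show "open W" by (rule W)
  show "inv_into W x (x w) = w" if "w \<in> W" for w
    using W(3) that by (auto simp: homeomorphism_def)
  show "open (x ` (U \<inter> W))" if "open U" for U
  proof -
    have "openin (top_of_set W) (U \<inter> W)"
      using that by (metis inf_commute openin_open_Int)
    then have "openin (top_of_set (x ` W)) (x ` (U \<inter> W))"
      using homeomorphism_imp_open_map[OF W(3)] by blast
    then show ?thesis
      using W(2) by (metis openin_open_eq)
  qed
qed

lemma smooth_fun_cong:
  assumes "smooth_manifold A" "smooth_fun A U \<phi>" "open V" "V \<subseteq> U" "\<And>q. q \<in> V \<Longrightarrow> \<phi> q = \<psi> q"
  shows "smooth_fun A V \<psi>"
  unfolding smooth_fun_def
proof (intro conjI ballI, fact, clarify)
  fix W x assume Wx: "(W, x) \<in> A"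
  note chart = smooth_manifold_chart[OF assms(1) Wx]
  have "smooth_on (x ` (U \<inter> W)) (\<phi> \<circ> inv_into W x)"
    using assms(2) Wx by (auto simp: smooth_fun_def)
  then show "smooth_on (x ` (V \<inter> W)) (\<psi> \<circ> inv_into W x)"
    by (rule smooth_on_cong_open[rotated 3])
       (use chart assms(3-5) in auto)
qed

lemma smooth_near_cong:
  assumes "smooth_manifold A" "open V" "p \<in> V" "\<And>q. q \<in> V \<Longrightarrow> \<phi> q = \<psi> q" "smooth_near A p \<phi>"
  shows "smooth_near A p \<psi>"
proof -
  obtain U where U: "p \<in> U" "smooth_fun A U \<phi>"
    using assms(5) by (auto simp: smooth_near_def)
  then have "open U"
    by (simp add: smooth_fun_def)
  then have "smooth_fun A (U \<inter> V) \<psi>"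
    using assms U by (intro smooth_fun_cong[OF assms(1) U(2)]) auto
  then show ?thesis
    using U(1) assms(3) by (auto simp: smooth_near_def)
qed

lemma smooth_near_zero: "smooth_near A p (\<lambda>_. 0)"
proof -
  have "smooth_fun A UNIV (\<lambda>_. 0)"
    by (auto simp: smooth_fun_def comp_def smooth_on_zero)
  then show ?thesis
    unfolding smooth_near_def by blast
qed

text \<open>If neither function is smooth near \<open>p\<close>, both values are the default 0.
  Otherwise the product rule is applied to the difference times a function vanishing on
  \<open>V\<close>.\<close>

lemma tangent_space_local:
  assumes "smooth_manifold A" "v \<in> tangent_space A p" "open V" "p \<in> V"
    and "\<And>q. q \<in> V \<Longrightarrow> \<phi> q = \<psi> q"
  shows "v \<phi> = v \<psi>"
proof (cases "smooth_near A p \<phi>")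
  case False
  then have "\<not> smooth_near A p \<psi>"
    using smooth_near_cong[OF assms(1,3,4), of \<psi> \<phi>] assms(5) by auto
  with False show ?thesis
    using assms(2) by (simp add: tangent_space_def)
next
  case True
  have \<psi>: "smooth_near A p \<psi>"
    by (rule smooth_near_cong[OF assms(1,3,4) _ True]) (rule assms(5))
  define \<eta> :: "'a \<Rightarrow> real" where "\<eta> = \<phi> - \<psi>"
  \<comment> \<open>No smooth cutoff is constructed: \<open>\<theta>\<close> is zero on
    \<open>V\<close>, hence smooth near \<open>p\<close>, and it is one wherever
    \<open>\<eta>\<close> can be nonzero, so \<open>\<eta> * \<theta> = \<eta>\<close> holds
    globally.\<close>
  define \<theta> :: "'a \<Rightarrow> real" where "\<theta> = indicator (- V)"
  have \<eta>: "smooth_near A p \<eta>"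
    by (rule smooth_near_cong[OF assms(1,3,4) _ smooth_near_zero]) (simp add: \<eta>_def assms(5))
  have \<theta>: "smooth_near A p \<theta>"
    by (rule smooth_near_cong[OF assms(1,3,4) _ smooth_near_zero]) (simp add: \<theta>_def)
  have "v (\<eta> * \<theta>) = \<eta> p * v \<theta> + \<theta> p * v \<eta>"
    using assms(2) \<eta> \<theta> by (simp add: tangent_space_def)
  moreover have "\<eta> * \<theta> = \<eta>"
    using assms(5) by (auto simp: fun_eq_iff \<eta>_def \<theta>_def indicator_def)
  moreover have "\<eta> p = 0" "\<theta> p = 0"
    using assms(4,5) by (simp_all add: \<eta>_def \<theta>_def)
  ultimately have "v \<eta> = 0"
    by simp
  moreover have "v (\<psi> + \<eta>) = v \<psi> + v \<eta>"
    using assms(2) \<psi> \<eta> by (simp add: tangent_space_def)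
  ultimately show ?thesis
    by (simp add: \<eta>_def)
qed

text \<open>A vector tangent to the submanifold differentiates only the restriction of a function
  along \<open>f\<close>. This is what makes derivatives independent of ambient extensions.
  Smoothness of both functions excludes the default branch of \<open>pushforward\<close>.\<close>

lemma pushforward_local:
  assumes "smooth_manifold B" "v \<in> tangent_space B p" "open V" "p \<in> V"
    and "smooth_near A (f p) \<phi>" "smooth_near A (f p) \<psi>" "\<And>q. q \<in> V \<Longrightarrow> \<phi> (f q) = \<psi> (f q)"
  shows "pushforward A f p v \<phi> = pushforward A f p v \<psi>"
  using tangent_space_local[OF assms(1-4), of "\<phi> \<circ> f" "\<psi> \<circ> f"] assms(5-7)
  by (simp add: pushforward_def)

lemma subspace_tangent_space: "subspace (tangent_space A p)"
  unfolding subspace_def tangent_space_def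
  by (auto simp: scaleR_fun_def algebra_simps)

lemma vector_field_subset:
  assumes "vector_field A U X" "open V" "V \<subseteq> U"
  shows "vector_field A V X"
  using assms by (auto simp: vector_field_def)

lemma vector_field_smooth_near:
  assumes "smooth_manifold A" "vector_field A U X" "p \<in> U" "smooth_near A p \<phi>"
  shows "smooth_near A p (\<lambda>q. X q \<phi>)"
proof -
  obtain V where V: "p \<in> V" "smooth_fun A V \<phi>"
    using assms(4) by (auto simp: smooth_near_def)
  have "open U" "open V"
    using assms(2) V by (auto simp: vector_field_def smooth_fun_def)
  then have "smooth_fun A (U \<inter> V) \<phi>"
    by (intro smooth_fun_cong[OF assms(1) V(2)]) auto
  then have "smooth_fun A (U \<inter> V) (\<lambda>q. X q \<phi>)"
    using assms(2) by (auto simp: vector_field_def)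
  then show ?thesis
    using assms(3) V(1) by (auto simp: smooth_near_def)
qed


section \<open>Symmetric bilinear forms on a subspace\<close>

definition linear_functional_on :: "'v::real_vector set \<Rightarrow> ('v \<Rightarrow> real) \<Rightarrow> bool" where
  "linear_functional_on V \<phi> \<longleftrightarrow>
     (\<forall>u\<in>V. \<forall>v\<in>V. \<forall>a b. \<phi> (a *\<^sub>R u + b *\<^sub>R v) = a * \<phi> u + b * \<phi> v)"

text \<open>Induction on the number of functionals: the identity is first obtained on the kernel of
  one functional \<open>\<phi> j\<close>, then extended to \<open>V\<close> by adjusting the
  coefficient of \<open>\<phi> j\<close>.\<close>

lemma functional_in_span_of_common_kernel:
  assumes "finite I" "subspace V" "linear_functional_on V \<psi>"
    and "\<And>i. i \<in> I \<Longrightarrow> linear_functional_on V (\<phi> i)"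
    and "\<And>v. v \<in> V \<Longrightarrow> (\<And>i. i \<in> I \<Longrightarrow> \<phi> i v = 0) \<Longrightarrow> \<psi> v = 0"
  shows "\<exists>c. \<forall>v\<in>V. \<psi> v = (\<Sum>i\<in>I. c i * \<phi> i v)"
  using assms
proof (induction I arbitrary: V rule: finite_induct)
  case empty
  then show ?case by auto
next
  case (insert j I)
  have j: "linear_functional_on V (\<phi> j)"
    using insert.prems by auto
  define K where "K = {v \<in> V. \<phi> j v = 0}"
  have "\<phi> j 0 = 0"
    using j subspace_0[OF insert.prems(1)]
    unfolding linear_functional_on_def by (metis mult_zero_left add_0 scaleR_zero_left)
  moreover have "\<phi> j (a *\<^sub>R u) = a * \<phi> j u" if "u \<in> V" for a u
    using j that unfolding linear_functional_on_def
    by (metis mult_zero_left add.right_neutral scaleR_zero_left)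
  moreover have "\<phi> j (u + v) = \<phi> j u + \<phi> j v" if "u \<in> V" "v \<in> V" for u v
    using j that unfolding linear_functional_on_def by (metis mult_1 scaleR_one)
  ultimately have "subspace K"
    using insert.prems(1) by (auto simp: K_def subspace_def)
  moreover have "linear_functional_on K \<psi>" "\<And>i. i \<in> I \<Longrightarrow> linear_functional_on K (\<phi> i)"
    using insert.prems(2,3) by (auto simp: K_def linear_functional_on_def)
  moreover have "\<psi> v = 0" if "v \<in> K" "\<And>i. i \<in> I \<Longrightarrow> \<phi> i v = 0" for v
    using that insert.prems(4)[of v] by (auto simp: K_def)
  ultimately obtain c where c: "\<And>v. v \<in> K \<Longrightarrow> \<psi> v = (\<Sum>i\<in>I. c i * \<phi> i v)"
    using insert.IH[of K] by blast
  show ?case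
  proof (cases "\<exists>v0\<in>V. \<phi> j v0 \<noteq> 0")
    case False
    then have "\<psi> v = (\<Sum>i\<in>insert j I. c i * \<phi> i v)" if "v \<in> V" for v
      using c[of v] insert.hyps that by (auto simp: K_def)
    then show ?thesis by blast
  next
    case True
    then obtain v0 where v0: "v0 \<in> V" "\<phi> j v0 \<noteq> 0" by blast
    \<comment> \<open>The new coefficient is the one forced by requiring the identity at
      \<open>v0\<close>.\<close>
    define c' where "c' = c(j := (\<psi> v0 - (\<Sum>i\<in>I. c i * \<phi> i v0)) / \<phi> j v0)"
    have "\<psi> v = (\<Sum>i\<in>insert j I. c' i * \<phi> i v)" if "v \<in> V" for v
    proof -
      \<comment> \<open>Subtracting \<open>t\<close> times \<open>v0\<close> moves \<open>v\<close>
        into the kernel \<open>K\<close>, where \<open>c\<close> is known to work.\<close>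
      define t where "t = \<phi> j v / \<phi> j v0"
      have comb: "\<omega> (1 *\<^sub>R v + (- t) *\<^sub>R v0) = 1 * \<omega> v + (- t) * \<omega> v0"
        if "linear_functional_on V \<omega>" for \<omega>
        using that \<open>v \<in> V\<close> v0(1) unfolding linear_functional_on_def by blast
      have "1 *\<^sub>R v + (- t) *\<^sub>R v0 \<in> V"
        using that v0(1) insert.prems(1) by (intro subspace_add subspace_scale)
      then have "1 *\<^sub>R v + (- t) *\<^sub>R v0 \<in> K"
        using comb[OF j] v0(2) by (simp add: K_def t_def)
      from c[OF this] have "\<psi> v - t * \<psi> v0 = (\<Sum>i\<in>I. c i * (\<phi> i v - t * \<phi> i v0))"
        using comb[OF insert.prems(2)] comb[OF insert.prems(3)] by simp
      also have "\<dots> = (\<Sum>i\<in>I. c i * \<phi> i v) - t * (\<Sum>i\<in>I. c i * \<phi> i v0)"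
        by (simp add: algebra_simps sum_subtractf sum_distrib_left)
      finally have "\<psi> v = (\<Sum>i\<in>I. c i * \<phi> i v) + t * (\<psi> v0 - (\<Sum>i\<in>I. c i * \<phi> i v0))"
        by (simp add: algebra_simps)
      also have "t * (\<psi> v0 - (\<Sum>i\<in>I. c i * \<phi> i v0)) = c' j * \<phi> j v"
        by (simp add: t_def c'_def)
      also have "(\<Sum>i\<in>I. c i * \<phi> i v) = (\<Sum>i\<in>I. c' i * \<phi> i v)"
        by (rule sum.cong) (use insert.hyps in \<open>auto simp: c'_def\<close>)
      finally show ?thesis
        using insert.hyps by simp
    qed
    then show ?thesis by blast
  qed
qed

text \<open>Bilinearity and symmetry are assumed on the carrier only, since a metric is
  unconstrained outside the tangent spaces.\<close>

locale symmetric_form_on =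
  fixes b :: "'v::real_vector \<Rightarrow> 'v \<Rightarrow> real" and T :: "'v set"
  assumes subspace_carrier: "subspace T"
    and lin: "\<lbrakk>u \<in> T; v \<in> T; w \<in> T\<rbrakk> \<Longrightarrow> b (\<alpha> *\<^sub>R u + \<beta> *\<^sub>R v) w = \<alpha> * b u w + \<beta> * b v w"
    and sym: "\<lbrakk>u \<in> T; v \<in> T\<rbrakk> \<Longrightarrow> b u v = b v u"
begin

lemma add_left: "\<lbrakk>u \<in> T; v \<in> T; w \<in> T\<rbrakk> \<Longrightarrow> b (u + v) w = b u w + b v w"
  using lin[of u v w 1 1] by simp

lemma scale_left: "\<lbrakk>u \<in> T; w \<in> T\<rbrakk> \<Longrightarrow> b (\<alpha> *\<^sub>R u) w = \<alpha> * b u w"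
  using lin[of u u w \<alpha> 0] by simp

lemma diff_left: "\<lbrakk>u \<in> T; v \<in> T; w \<in> T\<rbrakk> \<Longrightarrow> b (u - v) w = b u w - b v w"
  using lin[of u v w 1 "-1"] by simp

lemma zero_left: "w \<in> T \<Longrightarrow> b 0 w = 0"
  using scale_left[of w w 0] by simp

lemma add_right: "\<lbrakk>u \<in> T; v \<in> T; w \<in> T\<rbrakk> \<Longrightarrow> b u (v + w) = b u v + b u w"
  by (simp add: add_left subspace_add[OF subspace_carrier] sym[of u])

lemma scale_right: "\<lbrakk>u \<in> T; w \<in> T\<rbrakk> \<Longrightarrow> b u (\<alpha> *\<^sub>R w) = \<alpha> * b u w"
  by (simp add: scale_left subspace_scale[OF subspace_carrier] sym[of u])

lemma zero_right: "u \<in> T \<Longrightarrow> b u 0 = 0"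
  using zero_left sym[of u 0] subspace_0[OF subspace_carrier] by simp

lemma sum_left:
  assumes "\<And>i. i \<in> I \<Longrightarrow> s i \<in> T" "w \<in> T"
  shows "b (\<Sum>i\<in>I. c i *\<^sub>R s i) w = (\<Sum>i\<in>I. c i * b (s i) w)"
proof (cases "finite I")
  case True
  then show ?thesis
    using assms
    by (induction I rule: finite_induct)
       (simp_all add: zero_left add_left scale_left subspace_sum[OF subspace_carrier]
          subspace_scale[OF subspace_carrier])
qed (simp add: zero_left assms(2))

lemma perp_span:
  assumes "u \<in> T" "F \<subseteq> T" "\<And>w. w \<in> F \<Longrightarrow> b u w = 0" "w \<in> span F"
  shows "b u w = 0"
proof -
  have "w \<in> {w \<in> T. b u w = 0}"
    by (rule span_subspace_induct[OF assms(4)])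
       (use assms subspace_carrier in
         \<open>auto simp: subspace_def zero_right add_right scale_right\<close>)
  then show ?thesis by simp
qed

text \<open>The projection is obtained by representing the functional \<open>b w\<close> on
  \<open>span F\<close> as a combination of the functionals \<open>b u\<close> with \<open>u\<close>
  in \<open>F\<close>; its coefficients are those of \<open>e\<close>. This works for indefinite
  forms.\<close>

lemma orthogonal_projection:
  assumes "finite F" "F \<subseteq> T" "nondegenerate_on b (span F)" "w \<in> T"
  obtains e where "e \<in> span F" "\<And>v. v \<in> span F \<Longrightarrow> b (w - e) v = 0"
proof -
  have ET: "span F \<subseteq> T"
    using assms(2) subspace_carrier by (simp add: span_minimal)
  have lf: "linear_functional_on (span F) (b u)" if "u \<in> T" for u
    using that ET
    by (auto simp: linear_functional_on_def subset_iff add_right scale_right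
        subspace_scale[OF subspace_carrier])
  \<comment> \<open>Nondegeneracy makes the common kernel of the functionals \<open>b u\<close>
    trivial within \<open>span F\<close>, so \<open>b w\<close> vanishes on it.\<close>
  have "v = 0" if v: "v \<in> span F" "\<And>u. u \<in> F \<Longrightarrow> b u v = 0" for v
  proof -
    have "b v u = 0" if "u \<in> span F" for u
      by (rule perp_span[OF _ assms(2) _ that]) (use v ET assms(2) sym in \<open>auto simp: subset_iff\<close>)
    then show ?thesis
      using assms(3) v(1) by (auto simp: nondegenerate_on_def)
  qed
  then have "b w v = 0" if "v \<in> span F" "\<And>u. u \<in> F \<Longrightarrow> b u v = 0" for v
    using that zero_right[OF assms(4)] by metis
  then have "\<exists>c. \<forall>v\<in>span F. b w v = (\<Sum>u\<in>F. c u * b u v)"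
    by (intro functional_in_span_of_common_kernel)
       (use assms lf in \<open>auto simp: subspace_span\<close>)
  then obtain c where c: "\<And>v. v \<in> span F \<Longrightarrow> b w v = (\<Sum>u\<in>F. c u * b u v)"
    by blast
  define e where "e = (\<Sum>u\<in>F. c u *\<^sub>R u)"
  have e: "e \<in> span F"
    unfolding e_def by (intro span_sum span_scale span_base)
  have "b (w - e) v = 0" if "v \<in> span F" for v
  proof -
    have "b e v = (\<Sum>u\<in>F. c u * b u v)"
      unfolding e_def using that ET assms(2) by (intro sum_left) auto
    then show ?thesis
      using c[OF that] that e ET assms(4) diff_left[of w e v] by auto
  qed
  with e show ?thesis by (rule that)
qed

text \<open>Duality gives every \<open>l\<close> in the span of the \<open>N i\<close> the
  coordinates \<open>b (\<xi> i) l\<close>. The vectors satisfying this expansion form a subspace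
  containing each \<open>N j\<close>.\<close>

lemma dual_frame_separates:
  fixes \<xi> N :: "nat \<Rightarrow> 'v"
  assumes "\<And>i. i < r \<Longrightarrow> \<xi> i \<in> T" "\<And>i. i < r \<Longrightarrow> N i \<in> T"
    and "\<And>i j. i < r \<Longrightarrow> j < r \<Longrightarrow> b (\<xi> i) (N j) = (if i = j then 1 else 0)"
    and "l \<in> span (N ` {..<r})" "\<And>i. i < r \<Longrightarrow> b (\<xi> i) l = 0"
  shows "l = 0"
proof -
  have "l \<in> {l \<in> T. l = (\<Sum>i<r. b (\<xi> i) l *\<^sub>R N i)}"
  proof (rule subsetD[OF span_minimal assms(4)])
    show "subspace {l \<in> T. l = (\<Sum>i<r. b (\<xi> i) l *\<^sub>R N i)}" (is "subspace ?L")
    proof (rule subspaceI)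
      show "0 \<in> ?L"
        by (simp add: zero_right assms(1) subspace_0[OF subspace_carrier])
    next
      fix x y assume xy: "x \<in> ?L" "y \<in> ?L"
      then have "x \<in> T" "y \<in> T" by auto
      then have "(\<Sum>i<r. b (\<xi> i) (x + y) *\<^sub>R N i)
          = (\<Sum>i<r. b (\<xi> i) x *\<^sub>R N i) + (\<Sum>i<r. b (\<xi> i) y *\<^sub>R N i)"
        by (simp add: add_right assms(1) scaleR_add_left sum.distrib)
      then show "x + y \<in> ?L"
        using xy subspace_add[OF subspace_carrier] by simp
    next
      fix c x assume x: "x \<in> ?L"
      then have "x \<in> T" by auto
      then have "(\<Sum>i<r. b (\<xi> i) (c *\<^sub>R x) *\<^sub>R N i) = c *\<^sub>R (\<Sum>i<r. b (\<xi> i) x *\<^sub>R N i)"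
        by (simp add: scale_right assms(1) scaleR_sum_right)
      then show "c *\<^sub>R x \<in> ?L"
        using x subspace_scale[OF subspace_carrier] by simp
    qed
    show "N ` {..<r} \<subseteq> {l \<in> T. l = (\<Sum>i<r. b (\<xi> i) l *\<^sub>R N i)}"
    proof (rule image_subsetI)
      fix j assume "j \<in> {..<r}"
      then have "(\<Sum>i<r. b (\<xi> i) (N j) *\<^sub>R N i) = (\<Sum>i<r. if i = j then N i else 0)"
        by (intro sum.cong) (auto simp: assms(3))
      then have "N j = (\<Sum>i<r. b (\<xi> i) (N j) *\<^sub>R N i)"
        using \<open>j \<in> {..<r}\<close> by simp
      then show "N j \<in> {l \<in> T. l = (\<Sum>i<r. b (\<xi> i) l *\<^sub>R N i)}"
        using assms(2) \<open>j \<in> {..<r}\<close> by blast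
    qed
  qed
  then have "l = (\<Sum>i<r. b (\<xi> i) l *\<^sub>R N i)"
    by blast
  also have "\<dots> = 0"
    using assms(5) by simp
  finally show ?thesis .
qed

end


section \<open>Bundles along a submanifold\<close>

lemma subspace_set_plus:
  fixes E F :: "'v::real_vector set"
  assumes "subspace E" "subspace F"
  shows "subspace (E + F)"
proof -
  have "E + F = {x + y |x y. x \<in> E \<and> y \<in> F}"
    by (auto simp: set_plus_def)
  then show ?thesis
    using subspace_sums[OF assms] by simp
qed

lemma section_along_extension:
  assumes "section_along A f W Y" "p \<in> W"
  obtains V U Y' where "open V" "p \<in> V" "f ` V \<subseteq> U" "vector_field A U Y'"
    "\<And>q. q \<in> V \<Longrightarrow> Y' (f q) = Y q"
proof -
  have "\<exists>V U Y'. open V \<and> p \<in> V \<and> V \<subseteq> W \<and> f ` V \<subseteq> U \<and> vector_field A U Y' \<and>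
      (\<forall>q\<in>V. Y q = Y' (f q))"
    using assms unfolding section_along_def by blast
  then show ?thesis
    using that by auto
qed

lemma local_frame_in_tangent_space:
  assumes "local_frame A f k E W s" "p \<in> W"
  shows "(\<lambda>i. s i p) ` {..<k} \<subseteq> tangent_space A (f p)"
proof safe
  fix i assume "i < k"
  then have "section_along A f W (s i)"
    using assms(1) by (simp add: local_frame_def)
  then obtain V U Y' where "p \<in> V" "f ` V \<subseteq> U" "vector_field A U Y'" "Y' (f p) = s i p"
    using assms(2) by (metis section_along_extension)
  then show "s i p \<in> tangent_space A (f p)"
    unfolding vector_field_def by (metis image_subset_iff)
qed

lemma vector_subbundle_fibre:
  assumes "vector_subbundle A f E"
  shows "subspace (E p)" "E p \<subseteq> tangent_space A (f p)"
    and "\<exists>F. finite F \<and> E p = span F"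
proof -
  obtain k W s where W: "p \<in> W" "local_frame A f k E W s"
    using assms unfolding vector_subbundle_def by metis
  then have E: "span ((\<lambda>i. s i p) ` {..<k}) = E p"
    by (simp add: local_frame_def)
  show "subspace (E p)"
    using E by (metis subspace_span)
  show "E p \<subseteq> tangent_space A (f p)"
    using E local_frame_in_tangent_space[OF W(2,1)] span_minimal subspace_tangent_space by metis
  show "\<exists>F. finite F \<and> E p = span F"
    using E by (metis finite_imageI finite_lessThan)
qed

section \<open>The ambient tangent bundle along the submanifold as the sum of \<open>TM\<close> and
  \<open>tr\<close>\<close>

locale ambient_lightlike =
  fixes A :: "('a::{t2_space,second_countable_topology}, 'e::euclidean_space) atlas"
    and B :: "('b::{t2_space,second_countable_topology}, 'd::euclidean_space) atlas"
    and g :: "'a \<Rightarrow> 'a tvec \<Rightarrow> 'a tvec \<Rightarrow> real"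
    and nabla :: "('a \<Rightarrow> 'a tvec) \<Rightarrow> ('a \<Rightarrow> 'a tvec) \<Rightarrow> 'a \<Rightarrow> 'a tvec"
    and f :: "'b \<Rightarrow> 'a"
    and q r :: nat
    and ST STp ltr :: "'b \<Rightarrow> 'a tvec set"
  assumes manifold: "smooth_manifold A"
    and metric: "semi_riemannian_metric A q g"
    and levi_civita: "levi_civita_connection A g nabla"
    and lightlike: "lightlike_submanifold A g B f r ST STp ltr"
begin

abbreviation "T p \<equiv> tangent_space A (f p)"
abbreviation "TM p \<equiv> tangent_bundle A B f p"
abbreviation "Rad p \<equiv> radical A g B f p"
abbreviation "tr p \<equiv> transversal_bundle STp ltr p"

sublocale form: symmetric_form_on "g p" "tangent_space A p" for p
proof
  show "subspace (tangent_space A p)"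
    by (rule subspace_tangent_space)
  show "g p (\<alpha> *\<^sub>R u + \<beta> *\<^sub>R v) w = \<alpha> * g p u w + \<beta> * g p v w"
    if "u \<in> tangent_space A p" "v \<in> tangent_space A p" "w \<in> tangent_space A p" for u v w \<alpha> \<beta>
    using metric that unfolding semi_riemannian_metric_def by blast
  show "g p u v = g p v u" if "u \<in> tangent_space A p" "v \<in> tangent_space A p" for u v
    using metric that unfolding semi_riemannian_metric_def by blast
qed

lemma submanifold_smooth: "smooth_manifold B"
  using lightlike by (simp add: lightlike_submanifold_def submanifold_def)

lemma screen_frames:
  "\<exists>W \<xi> N. open W \<and> p \<in> W \<and>
     local_frame A f r (radical A g B f) W \<xi> \<and> local_frame A f r ltr W N \<and>
     (\<forall>q\<in>W. \<forall>i<r. \<forall>j<r. g (f q) (\<xi> i q) (N j q) = (if i = j then 1 else 0) \<and>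
        g (f q) (N i q) (N j q) = 0)"
  using lightlike unfolding lightlike_submanifold_def by (elim conjE) (erule spec)

text \<open>For \<open>radical\<close> and \<open>ltr\<close>, the dual frames of length
  \<open>r\<close> around each point provide the local frames.\<close>

lemma subbundles:
  "vector_subbundle A f ST" "vector_subbundle A f STp"
  "vector_subbundle A f (radical A g B f)" "vector_subbundle A f ltr"
proof -
  show "vector_subbundle A f ST" "vector_subbundle A f STp"
    using lightlike unfolding lightlike_submanifold_def by blast+
  show "vector_subbundle A f (radical A g B f)" "vector_subbundle A f ltr"
    unfolding vector_subbundle_def using screen_frames by (metis (no_types, lifting))+
qed

lemmas ST_fibre = vector_subbundle_fibre[OF subbundles(1)]
lemmas STp_fibre = vector_subbundle_fibre[OF subbundles(2)]
lemmas Rad_fibre = vector_subbundle_fibre[OF subbundles(3)]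
lemmas ltr_fibre = vector_subbundle_fibre[OF subbundles(4)]

lemma screen_decompositions:
  "orth_direct_sum (g (f p)) (TM p) (ST p) (Rad p)"
  "orth_direct_sum (g (f p)) (normal_bundle A g B f p) (STp p) (Rad p)"
  "direct_sum {v \<in> T p. \<forall>w\<in>ST p + STp p. g (f p) v w = 0} (Rad p) (ltr p)"
  "nondegenerate_on (g (f p)) (ST p)" "nondegenerate_on (g (f p)) (STp p)"
  using lightlike by (simp_all add: lightlike_submanifold_def)

lemma tangent_bundle_eq: "TM p = ST p + Rad p"
  using screen_decompositions(1) by (simp add: orth_direct_sum_def direct_sum_def)

lemma normal_bundle_eq: "normal_bundle A g B f p = STp p + Rad p"
  using screen_decompositions(2) by (simp add: orth_direct_sum_def direct_sum_def)

lemma subspace_TM: "subspace (TM p)"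
  unfolding tangent_bundle_eq by (intro subspace_set_plus ST_fibre Rad_fibre)

lemma subspace_tr: "subspace (tr p)"
  unfolding transversal_bundle_def by (intro subspace_set_plus STp_fibre ltr_fibre)

lemma TM_sub_T: "TM p \<subseteq> T p"
  using ST_fibre(2)[of p] Rad_fibre(2)[of p] unfolding tangent_bundle_eq
  by (auto elim!: set_plus_elim intro!: subspace_add[OF subspace_tangent_space])

lemma ST_sub_TM: "ST p \<subseteq> TM p" and Rad_sub_TM: "Rad p \<subseteq> TM p"
  unfolding tangent_bundle_eq
  using set_zero_plus2[OF subspace_0[OF Rad_fibre(1)[of p]], where B = "ST p"]
    set_zero_plus2[OF subspace_0[OF ST_fibre(1)[of p]], where B = "Rad p"]
  by (simp_all add: add.commute)

lemma STp_sub_tr: "STp p \<subseteq> tr p"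
  unfolding transversal_bundle_def
  using set_zero_plus2[OF subspace_0[OF ltr_fibre(1)[of p]], where B = "STp p"] by simp

lemma STp_sub_normal: "STp p \<subseteq> normal_bundle A g B f p"
  unfolding normal_bundle_eq
  using set_zero_plus2[OF subspace_0[OF Rad_fibre(1)[of p]], where B = "STp p"]
  by (simp add: add.commute)

text \<open>This gives uniqueness in the Gauss formula. Writing \<open>v = l + s\<close>, a radical
  vector is orthogonal to \<open>v\<close> because it is normal, and to \<open>s\<close> because it
  is tangent. So it is orthogonal to \<open>l\<close>, and the dual frames force
  \<open>l = 0\<close>. Then \<open>s\<close> is both tangent and normal, hence in
  \<open>STp p \<inter> Rad p\<close>.\<close>

lemma TM_tr_disjoint:
  assumes "v \<in> TM p" "v \<in> tr p"
  shows "v = 0"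
proof -
  obtain l s where v: "v = l + s" "l \<in> ltr p" "s \<in> STp p"
    using assms(2) by (auto simp: transversal_bundle_def elim: set_plus_elim)
  obtain W \<xi> N where W: "p \<in> W"
    "local_frame A f r (radical A g B f) W \<xi>" "local_frame A f r ltr W N"
    "\<forall>x\<in>W. \<forall>i<r. \<forall>j<r. g (f x) (\<xi> i x) (N j x) = (if i = j then 1 else 0) \<and>
       g (f x) (N i x) (N j x) = 0"
    using screen_frames[of p] by blast
  have dual: "g (f p) (\<xi> i p) (N j p) = (if i = j then 1 else 0)" if "i < r" "j < r" for i j
    using W(1,4) that by blast
  have span: "span ((\<lambda>i. \<xi> i p) ` {..<r}) = Rad p" "span ((\<lambda>i. N i p) ` {..<r}) = ltr p"
    using W by (auto simp: local_frame_def)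
  have \<xi>: "\<xi> i p \<in> Rad p" if "i < r" for i
    using that unfolding span(1)[symmetric] by (intro span_base) auto
  have T: "l \<in> T p" "s \<in> T p"
    using v ltr_fibre(2) STp_fibre(2) by auto
  have "g (f p) (\<xi> i p) l = 0" if "i < r" for i
  proof -
    have \<xi>T: "\<xi> i p \<in> T p"
      using \<xi>[OF that] Rad_fibre(2) by blast
    have "g (f p) (\<xi> i p) v = 0"
      using \<xi>[OF that] assms(1) by (auto simp: radical_def normal_bundle_def)
    moreover have "g (f p) s (\<xi> i p) = 0"
      using \<xi>[OF that] v(3) STp_sub_normal by (auto simp: radical_def normal_bundle_def)
    ultimately show ?thesis
      using form.add_right[OF \<xi>T T] form.sym[OF \<xi>T T(2)] v(1) by simp
  qed
  then have "l = 0"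
    using dual local_frame_in_tangent_space[OF W(2,1)] local_frame_in_tangent_space[OF W(3,1)]
      v(2) span(2)
    by (intro form.dual_frame_separates[of r "\<lambda>i. \<xi> i p" "f p" "\<lambda>i. N i p"]) auto
  then have "s \<in> STp p \<inter> Rad p"
    using v assms(1) STp_sub_normal by (auto simp: radical_def)
  also have "STp p \<inter> Rad p = {0}"
    using screen_decompositions(2) by (simp add: orth_direct_sum_def direct_sum_def)
  finally show ?thesis
    using v(1) \<open>l = 0\<close> by simp
qed

text \<open>Project away the nondegenerate bundles \<open>ST\<close> and \<open>STp\<close> in turn;
  what remains is orthogonal to both and splits into \<open>Rad\<close> and \<open>ltr\<close> by
  the choice of \<open>ltr\<close>.\<close>

lemma tangent_space_decomposition:
  assumes "w \<in> T p"
  obtains s n k l where "s \<in> ST p" "n \<in> STp p" "k \<in> Rad p" "l \<in> ltr p" "w = s + n + k + l"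
proof -
  have proj: "\<exists>e\<in>E p. \<forall>v\<in>E p. g (f p) (u - e) v = 0"
    if E: "vector_subbundle A f E" "nondegenerate_on (g (f p)) (E p)" "u \<in> T p" for E u
  proof -
    obtain F where F: "finite F" "E p = span F"
      using vector_subbundle_fibre(3)[OF E(1)] by blast
    have "F \<subseteq> T p"
      using F(2) vector_subbundle_fibre(2)[OF E(1), of p] span_superset by blast
    then show ?thesis
      using form.orthogonal_projection[of F "f p" u] E(2,3) F by metis
  qed
  obtain s where s: "s \<in> ST p" "\<And>v. v \<in> ST p \<Longrightarrow> g (f p) (w - s) v = 0"
    using proj[OF subbundles(1) screen_decompositions(4) assms] by blast
  have sT: "s \<in> T p"
    using s ST_fibre(2) by blast
  have wsT: "w - s \<in> T p"
    using assms sT by (intro subspace_diff[OF subspace_tangent_space])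
  obtain n where n: "n \<in> STp p" "\<And>v. v \<in> STp p \<Longrightarrow> g (f p) (w - s - n) v = 0"
    using proj[OF subbundles(2) screen_decompositions(5) wsT] by blast
  have nT: "n \<in> T p"
    using n STp_fibre(2) by blast
  have wT: "w - s - n \<in> T p"
    by (rule subspace_diff[OF subspace_tangent_space wsT nT])
  \<comment> \<open>The second projection preserves orthogonality to \<open>ST\<close> because
    \<open>n\<close> is normal and \<open>ST\<close> is tangent.\<close>
  have "g (f p) (w - s - n) v = 0" if "v \<in> ST p" for v
  proof -
    have vT: "v \<in> T p"
      using that ST_fibre(2) by blast
    have "g (f p) n v = 0"
      using n(1) that STp_sub_normal[of p] ST_sub_TM[of p] unfolding normal_bundle_def by blast
    then show ?thesis
      using s(2)[OF that] form.diff_left[OF wsT nT vT] by simp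
  qed
  then have "g (f p) (w - s - n) v = 0" if "v \<in> ST p + STp p" for v
    using that n(2) ST_fibre(2)[of p] STp_fibre(2)[of p] form.add_right[OF wT]
    by (auto elim!: set_plus_elim simp: subset_iff)
  then have "w - s - n \<in> {v \<in> T p. \<forall>w\<in>ST p + STp p. g (f p) v w = 0}"
    using wT by blast
  also have "\<dots> = Rad p + ltr p"
    using screen_decompositions(3) by (simp add: direct_sum_def)
  finally obtain k l where "k \<in> Rad p" "l \<in> ltr p" "w - s - n = k + l"
    by (elim set_plus_elim)
  moreover from this have "w = s + n + k + l"
    by (simp add: algebra_simps)
  ultimately show ?thesis
    using s(1) n(1) that by blast
qed

text \<open>Existence in the Gauss formula: \<open>ST\<close> and \<open>Rad\<close> parts are
  tangent, \<open>ltr\<close> and \<open>STp\<close> parts transversal.\<close>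

lemma ambient_eq_TM_plus_tr: "T p \<subseteq> TM p + tr p"
proof
  fix w assume "w \<in> T p"
  then obtain s n k l where d: "s \<in> ST p" "n \<in> STp p" "k \<in> Rad p" "l \<in> ltr p"
    "w = s + n + k + l"
    by (rule tangent_space_decomposition)
  then have "s + k \<in> TM p" "l + n \<in> tr p"
    unfolding tangent_bundle_eq transversal_bundle_def by (auto intro: set_plus_intro)
  then have "(s + k) + (l + n) \<in> TM p + tr p"
    by (rule set_plus_intro)
  then show "w \<in> TM p + tr p"
    using d(5) by (simp add: algebra_simps)
qed

text \<open>Nondegeneracy tests against vectors, whereas metric compatibility supplies information
  only for fields. The bridge is that frame sections extend to ambient fields, and their values at
  \<open>f p\<close> span the four summands of the tangent space.\<close>

lemma eq_zero_if_orthogonal_to_fields: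
  assumes "u \<in> T p"
    and "\<And>U Z. f p \<in> U \<Longrightarrow> vector_field A U Z \<Longrightarrow> g (f p) u (Z (f p)) = 0"
  shows "u = 0"
proof -
  have perp: "g (f p) u w = 0" if E: "vector_subbundle A f E" "w \<in> E p" for E w
  proof -
    obtain k W s where W: "p \<in> W" "local_frame A f k E W s"
      using E(1) unfolding vector_subbundle_def by metis
    have "g (f p) u (s i p) = 0" if "i < k" for i
    proof -
      have "section_along A f W (s i)"
        using W(2) \<open>i < k\<close> by (simp add: local_frame_def)
      then obtain V U Z where "p \<in> V" "f ` V \<subseteq> U" "vector_field A U Z" "Z (f p) = s i p"
        using W(1) by (metis section_along_extension)
      then show ?thesis
        using assms(2)[of U Z] by auto
    qed
    moreover have "w \<in> span ((\<lambda>i. s i p) ` {..<k})"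
      using W E(2) by (simp add: local_frame_def)
    ultimately show ?thesis
      using form.perp_span[OF assms(1) local_frame_in_tangent_space[OF W(2,1)]] by auto
  qed
  have "g (f p) u w = 0" if "w \<in> T p" for w
  proof -
    obtain s n k l where d: "s \<in> ST p" "n \<in> STp p" "k \<in> Rad p" "l \<in> ltr p"
      "w = s + n + k + l"
      using \<open>w \<in> T p\<close> by (rule tangent_space_decomposition)
    have "s \<in> T p" "n \<in> T p" "k \<in> T p" "l \<in> T p"
      using d ST_fibre(2)[of p] STp_fibre(2)[of p] Rad_fibre(2)[of p] ltr_fibre(2)[of p] by blast+
    then show ?thesis
      using d assms(1) perp subbundles
      by (simp add: form.add_right subspace_add[OF subspace_tangent_space])
  qed
  then show ?thesis
    using metric assms(1) by (auto simp: semi_riemannian_metric_def nondegenerate_on_def)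
qed


section \<open>The covariant derivative along the submanifold\<close>

lemma nabla_vector_field:
  "vector_field A U X \<Longrightarrow> vector_field A U Y \<Longrightarrow> vector_field A U (nabla X Y)"
  using levi_civita by (auto simp: levi_civita_connection_def affine_connection_def)

text \<open>Metric compatibility expresses \<open>g (nabla X Y) Z\<close> as the derivative of
  \<open>g Y Z\<close> along \<open>X\<close> minus \<open>g Y (nabla X Z)\<close>. At
  \<open>f p\<close> the second term sees only the value of \<open>Y\<close>, and the first only its
  values along \<open>f\<close>, because \<open>X (f p)\<close> is a pushforward.\<close>

lemma nabla_second_arg_cong:
  assumes U: "vector_field A U X" "vector_field A U Y" "vector_field A U Y'"
    and V: "open V" "p \<in> V" "f ` V \<subseteq> U" "\<And>x. x \<in> V \<Longrightarrow> Y (f x) = Y' (f x)"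
    and tangent: "X (f p) \<in> TM p"
  shows "nabla X Y (f p) = nabla X Y' (f p)"
proof -
  have fpU: "f p \<in> U"
    using V by auto
  have in_T: "Z (f p) \<in> T p" if "vector_field A U' Z" "f p \<in> U'" for Z U'
    using that by (auto simp: vector_field_def)
  have nT: "nabla X Y (f p) \<in> T p" "nabla X Y' (f p) \<in> T p"
    using in_T nabla_vector_field U fpU by blast+
  obtain v where v: "v \<in> tangent_space B p" "X (f p) = pushforward A f p v"
    using tangent by (auto simp: tangent_bundle_def)
  have "nabla X Y (f p) - nabla X Y' (f p) = 0"
  proof (rule eq_zero_if_orthogonal_to_fields)
    show "nabla X Y (f p) - nabla X Y' (f p) \<in> T p"
      using nT by (intro subspace_diff[OF subspace_tangent_space])
    fix U1 Z assume Z: "f p \<in> U1" "vector_field A U1 Z"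
    \<comment> \<open>The test field has its own domain, while compatibility needs one domain for
      all the fields.\<close>
    define U2 where "U2 = U \<inter> U1"
    have "open U2"
      using Z U by (auto simp: U2_def vector_field_def)
    then have on_U2: "vector_field A U2 X" "vector_field A U2 Y" "vector_field A U2 Y'"
      "vector_field A U2 Z"
      using U Z vector_field_subset by (auto simp: U2_def)
    have fp: "f p \<in> U2"
      using fpU Z by (simp add: U2_def)
    have compat: "X (f p) (\<lambda>x. g x (W x) (Z x))
        = g (f p) (nabla X W (f p)) (Z (f p)) + g (f p) (W (f p)) (nabla X Z (f p))"
      if "vector_field A U2 W" for W
      using levi_civita on_U2 fp that unfolding levi_civita_connection_def by blast
    have smooth: "smooth_near A (f p) (\<lambda>x. g x (W x) (Z x))" if "vector_field A U2 W" for W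
      using metric on_U2(4) that fp unfolding semi_riemannian_metric_def smooth_near_def by blast
    have "X (f p) (\<lambda>x. g x (Y x) (Z x)) = X (f p) (\<lambda>x. g x (Y' x) (Z x))"
      unfolding v(2)
      by (rule pushforward_local[OF submanifold_smooth v(1) V(1,2)])
         (use smooth on_U2 V(4) in auto)
    then have "g (f p) (nabla X Y (f p)) (Z (f p)) = g (f p) (nabla X Y' (f p)) (Z (f p))"
      using compat[OF on_U2(2)] compat[OF on_U2(3)] V(2,4) by simp
    then show "g (f p) (nabla X Y (f p) - nabla X Y' (f p)) (Z (f p)) = 0"
      using form.diff_left[OF nT in_T[OF Z(2,1)]] by simp
  qed
  then show ?thesis by simp
qed

text \<open>Vanishing torsion rewrites \<open>nabla X Y\<close> as \<open>nabla Y X\<close> plus the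
  bracket. With \<open>Y (f p)\<close> tangent, the previous lemma handles the first term, and the
  bracket differentiates the components of \<open>X\<close> only along the submanifold.\<close>

lemma nabla_first_arg_cong:
  assumes U: "vector_field A U X" "vector_field A U X'" "vector_field A U Y"
    and V: "open V" "p \<in> V" "f ` V \<subseteq> U" "\<And>x. x \<in> V \<Longrightarrow> X (f x) = X' (f x)"
    and tangent: "Y (f p) \<in> TM p"
  shows "nabla X Y (f p) = nabla X' Y (f p)"
proof -
  have fpU: "f p \<in> U"
    using V by auto
  obtain v where v: "v \<in> tangent_space B p" "Y (f p) = pushforward A f p v"
    using tangent by (auto simp: tangent_bundle_def)
  have "Y (f p) (\<lambda>x. X x \<phi>) = Y (f p) (\<lambda>x. X' x \<phi>)" if "smooth_near A (f p) \<phi>" for \<phi>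
    unfolding v(2)
    by (rule pushforward_local[OF submanifold_smooth v(1) V(1,2)])
       (use vector_field_smooth_near[OF manifold _ fpU that] U V(4) in auto)
  then have "lie_bracket A X Y (f p) = lie_bracket A X' Y (f p)"
    using V(2,4) by (simp add: lie_bracket_def fun_eq_iff)
  moreover have "nabla X Y (f p) - nabla Y X (f p) = lie_bracket A X Y (f p)"
    "nabla X' Y (f p) - nabla Y X' (f p) = lie_bracket A X' Y (f p)"
    using levi_civita U fpU unfolding levi_civita_connection_def by blast+
  moreover have "nabla Y X (f p) = nabla Y X' (f p)"
    by (rule nabla_second_arg_cong[OF U(3,1,2) V tangent])
  ultimately show ?thesis
    by (metis diff_add_cancel)
qed

text \<open>This evaluates the definite description in \<open>cov_along\<close> through any pair of
  extensions. Two pairs are compared on the intersection of their domains, replacing the second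
  field first and then the first.\<close>

lemma cov_along_eq:
  assumes "open V" "p \<in> V" "f ` V \<subseteq> U" "vector_field A U X'" "vector_field A U Y'"
    and "\<And>x. x \<in> V \<Longrightarrow> X' (f x) = X x" "\<And>x. x \<in> V \<Longrightarrow> Y' (f x) = Y x"
    and tangent: "X p \<in> TM p" "Y p \<in> TM p"
  shows "cov_along A f nabla X Y p = nabla X' Y' (f p)"
  unfolding cov_along_def
proof (rule the_equality, goal_cases)
  case 1
  show ?case using assms by blast
next
  case (2 w)
  then obtain V1 U1 X1 Y1 where 1: "open V1" "p \<in> V1" "f ` V1 \<subseteq> U1"
    "vector_field A U1 X1" "vector_field A U1 Y1"
    "\<And>x. x \<in> V1 \<Longrightarrow> X1 (f x) = X x" "\<And>x. x \<in> V1 \<Longrightarrow> Y1 (f x) = Y x"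
    "w = nabla X1 Y1 (f p)"
    by blast
  define U2 V2 where "U2 = U \<inter> U1" and "V2 = V \<inter> V1"
  have V2: "open V2" "p \<in> V2" "f ` V2 \<subseteq> U2"
    using assms(1-3) 1 by (auto simp: U2_def V2_def)
  have "open U2"
    using assms(4) 1(4) by (auto simp: U2_def vector_field_def)
  then have U2: "vector_field A U2 X'" "vector_field A U2 Y'" "vector_field A U2 X1"
    "vector_field A U2 Y1"
    using assms(4,5) 1(4,5) by (auto simp: U2_def intro: vector_field_subset)
  have "nabla X1 Y1 (f p) = nabla X1 Y' (f p)"
    by (rule nabla_second_arg_cong[OF U2(3,4,2) V2]) (use assms 1 in \<open>auto simp: V2_def\<close>)
  also have "\<dots> = nabla X' Y' (f p)"
    by (rule nabla_first_arg_cong[OF U2(3,1,2) V2]) (use assms 1 in \<open>auto simp: V2_def\<close>)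
  finally show ?case
    using 1(8) by simp
qed

lemma common_extension:
  assumes "section_along A f UNIV X" "section_along A f UNIV Y"
  obtains V U X' Y' where "open V" "p \<in> V" "f ` V \<subseteq> U" "vector_field A U X'"
    "vector_field A U Y'" "\<And>x. x \<in> V \<Longrightarrow> X' (f x) = X x" "\<And>x. x \<in> V \<Longrightarrow> Y' (f x) = Y x"
proof -
  obtain V1 U1 X' where 1: "open V1" "p \<in> V1" "f ` V1 \<subseteq> U1" "vector_field A U1 X'"
    "\<And>x. x \<in> V1 \<Longrightarrow> X' (f x) = X x"
    by (rule section_along_extension[OF assms(1), of p]) auto
  obtain V2 U2 Y' where 2: "open V2" "p \<in> V2" "f ` V2 \<subseteq> U2" "vector_field A U2 Y'"
    "\<And>x. x \<in> V2 \<Longrightarrow> Y' (f x) = Y x"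
    by (rule section_along_extension[OF assms(2), of p]) auto
  have "open (U1 \<inter> U2)"
    using 1 2 by (auto simp: vector_field_def)
  then have "vector_field A (U1 \<inter> U2) X'" "vector_field A (U1 \<inter> U2) Y'"
    by (auto intro: vector_field_subset[OF 1(4)] vector_field_subset[OF 2(4)])
  then show ?thesis
    using 1 2 by (intro that[of "V1 \<inter> V2" "U1 \<inter> U2" X' Y']) auto
qed

text \<open>One pair of extensions computes the derivative at every point of \<open>V\<close>, so
  \<open>nabla X' Y'\<close> itself is the ambient extension required near \<open>p\<close>.\<close>

lemma section_along_cov_along:
  assumes "section_along A f UNIV X" "section_along A f UNIV Y"
    and "\<And>p. X p \<in> TM p" "\<And>p. Y p \<in> TM p"
  shows "section_along A f UNIV (cov_along A f nabla X Y)"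
  unfolding section_along_def
proof (intro conjI ballI open_UNIV)
  fix p
  obtain V U X' Y' where ext: "open V" "p \<in> V" "f ` V \<subseteq> U" "vector_field A U X'"
    "vector_field A U Y'" "\<And>x. x \<in> V \<Longrightarrow> X' (f x) = X x" "\<And>x. x \<in> V \<Longrightarrow> Y' (f x) = Y x"
    by (rule common_extension[OF assms(1,2), of p]) blast
  have "cov_along A f nabla X Y x = nabla X' Y' (f x)" if "x \<in> V" for x
    by (rule cov_along_eq[OF ext(1) that ext(3-7) assms(3,4)])
  then show "\<exists>V U Y'. open V \<and> p \<in> V \<and> V \<subseteq> UNIV \<and> f ` V \<subseteq> U \<and> vector_field A U Y' \<and>
      (\<forall>x\<in>V. cov_along A f nabla X Y x = Y' (f x))"
    using ext nabla_vector_field[OF ext(4,5)] by blast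
qed

lemma section_along_in_tangent_space: "section_along A f UNIV Y \<Longrightarrow> Y p \<in> T p"
  by (rule section_along_extension[of A f UNIV Y p])
    (simp_all add: vector_field_def, metis image_subset_iff)

section \<open>Vanishing of the transversal part in the Gauss formula\<close>

lemma second_fundamental_form_eq_0_iff:
  assumes "cov_along A f nabla X Y p \<in> T p"
  shows "second_fundamental_form A nabla B f tr X Y p = 0 \<longleftrightarrow> cov_along A f nabla X Y p \<in> TM p"
proof -
  have "cov_along A f nabla X Y p \<in> TM p + tr p"
    using assms ambient_eq_TM_plus_tr by blast
  then obtain u t where ut: "u \<in> TM p" "t \<in> tr p" "cov_along A f nabla X Y p = u + t"
    by (auto elim: set_plus_elim)
  have unique: "t' = t''" if "t' \<in> tr p" "t'' \<in> tr p" "u' \<in> TM p" "u'' \<in> TM p"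
    "u' + t' = u'' + t''" for u' u'' t' t''
  proof -
    have "t' - t'' \<in> tr p" "u'' - u' \<in> TM p"
      using that by (auto intro: subspace_diff[OF subspace_tr] subspace_diff[OF subspace_TM])
    moreover have "t' - t'' = u'' - u'"
      using that(5) by (simp add: algebra_simps)
    ultimately show ?thesis
      using TM_tr_disjoint by (metis right_minus_eq)
  qed
  have "second_fundamental_form A nabla B f tr X Y p = t"
    unfolding second_fundamental_form_def
    by (rule the_equality) (use ut unique in \<open>auto\<close>)
  \<comment> \<open>If \<open>u + t\<close> is tangent, then \<open>u + t\<close> and
    \<open>(u + t) + 0\<close> are two decompositions of the same vector, whence
    \<open>t = 0\<close>.\<close>
  moreover have "t = 0 \<longleftrightarrow> cov_along A f nabla X Y p \<in> TM p"
    using ut unique[of t 0 u "u + t"] subspace_0[OF subspace_tr] by auto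
  ultimately show ?thesis by simp
qed

end


section \<open>The distribution of an STCR lightlike submanifold\<close>

locale kaehler_stcr =
  fixes A :: "('a::{t2_space,second_countable_topology}, 'e::euclidean_space) atlas"
    and B :: "('b::{t2_space,second_countable_topology}, 'd::euclidean_space) atlas"
    and g :: "'a \<Rightarrow> 'a tvec \<Rightarrow> 'a tvec \<Rightarrow> real"
    and J :: "'a \<Rightarrow> 'a tvec \<Rightarrow> 'a tvec"
    and nabla :: "('a \<Rightarrow> 'a tvec) \<Rightarrow> ('a \<Rightarrow> 'a tvec) \<Rightarrow> 'a \<Rightarrow> 'a tvec"
    and f :: "'b \<Rightarrow> 'a"
    and q r :: nat
    and ST STp ltr D0 D1 D2 Dp L1 L2 S :: "'b \<Rightarrow> 'a tvec set"
  assumes kaehler: "indefinite_kaehler_manifold A q g J nabla"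
    and stcr: "stcr_lightlike_submanifold A g J B f r ST STp ltr D0 D1 D2 Dp L1 L2 S"

sublocale kaehler_stcr \<subseteq> ambient_lightlike A B g nabla f q r ST STp ltr
proof
  show "smooth_manifold A" "semi_riemannian_metric A q g" "levi_civita_connection A g nabla"
    using kaehler by (simp_all add: indefinite_kaehler_manifold_def)
  show "lightlike_submanifold A g B f r ST STp ltr"
    using stcr by (simp add: stcr_lightlike_submanifold_def)
qed

context kaehler_stcr
begin

abbreviation "D \<equiv> stcr_distribution J f D0 D1"

lemma almost_complex: "almost_complex_structure A J"
  using kaehler by (simp add: indefinite_kaehler_manifold_def)

lemma J_in_tangent_space: "v \<in> tangent_space A x \<Longrightarrow> J x v \<in> tangent_space A x"
  and J_J: "v \<in> tangent_space A x \<Longrightarrow> J x (J x v) = - v"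
  using almost_complex by (auto simp: almost_complex_structure_def)

lemma J_add:
  assumes "u \<in> tangent_space A x" "v \<in> tangent_space A x"
  shows "J x (u + v) = J x u + J x v"
proof -
  have "J x (1 *\<^sub>R u + 1 *\<^sub>R v) = 1 *\<^sub>R J x u + 1 *\<^sub>R J x v"
    using almost_complex assms unfolding almost_complex_structure_def by blast
  then show ?thesis by simp
qed

lemma J_zero: "J x 0 = 0"
  using J_add[of 0 x 0] subspace_0[OF subspace_tangent_space[of A x]] by simp

lemma J_vector_field: "vector_field A U X \<Longrightarrow> vector_field A U (\<lambda>x. J x (X x))"
  using almost_complex by (simp add: almost_complex_structure_def)

lemma D0_fibre: "D0 p \<subseteq> ST p" "J (f p) ` D0 p = D0 p"
  and D1_fibre: "vector_subbundle A f D1" "D1 p \<subseteq> Rad p" "J (f p) ` D1 p \<subseteq> ST p"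
  and D2_fibre: "D2 p \<subseteq> Rad p" "J (f p) ` D2 p \<subseteq> STp p"
  and Dp_fibre: "Dp p \<subseteq> ST p"
  and L1_fibre: "L1 p \<subseteq> ltr p"
  and S_fibre: "S p \<subseteq> STp p"
  using stcr unfolding stcr_lightlike_submanifold_def subbundle_of_def by simp_all

lemma Rad_eq: "Rad p = D1 p + D2 p"
  and ST_eq: "ST p = J (f p) ` D1 p + Dp p + D0 p"
  and J_Dp_eq: "J (f p) ` Dp p = L1 p + S p"
proof -
  have "direct_sum (Rad p) (D1 p) (D2 p)"
    "orth_direct_sum (g (f p)) (ST p) (J (f p) ` D1 p + Dp p) (D0 p)"
    "orth_direct_sum (g (f p)) (J (f p) ` Dp p) (L1 p) (S p)"
    using stcr unfolding stcr_lightlike_submanifold_def by simp_all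
  then show "Rad p = D1 p + D2 p" "ST p = J (f p) ` D1 p + Dp p + D0 p"
    "J (f p) ` Dp p = L1 p + S p"
    by (simp_all add: orth_direct_sum_def direct_sum_def)
qed

lemma D_cases:
  assumes "v \<in> D p"
  obtains a b c where "a \<in> D0 p" "b \<in> D1 p" "c \<in> D1 p" "v = a + b + J (f p) c"
  using assms unfolding stcr_distribution_def by (auto elim!: set_plus_elim)

lemma D_intro:
  assumes "a \<in> D0 p" "b \<in> D1 p" "c \<in> D1 p"
  shows "a + b + J (f p) c \<in> D p"
  using assms unfolding stcr_distribution_def by (intro set_plus_intro) auto

lemma D_sub_TM: "D p \<subseteq> TM p"
proof
  fix v assume "v \<in> D p"
  then obtain a b c where v: "a \<in> D0 p" "b \<in> D1 p" "c \<in> D1 p" "v = a + b + J (f p) c"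
    by (rule D_cases)
  then have "a \<in> TM p" "b \<in> TM p" "J (f p) c \<in> TM p"
    using D0_fibre(1)[of p] D1_fibre(2,3)[of p] ST_sub_TM[of p] Rad_sub_TM[of p] by blast+
  then show "v \<in> TM p"
    using subspace_add[OF subspace_TM] v(4) by simp
qed

text \<open>\<open>J\<close> preserves \<open>D0\<close> and, up to sign, exchanges
  \<open>D1\<close> with its image under \<open>J\<close>.\<close>

lemma J_D:
  assumes "v \<in> D p"
  shows "J (f p) v \<in> D p"
proof -
  obtain a b c where abc: "a \<in> D0 p" "b \<in> D1 p" "c \<in> D1 p" "v = a + b + J (f p) c"
    using assms by (rule D_cases)
  have T: "a \<in> T p" "b \<in> T p" "c \<in> T p"
    using abc D0_fibre(1)[of p] D1_fibre(2)[of p] ST_fibre(2)[of p] Rad_fibre(2)[of p] by blast+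
  have "J (f p) v = J (f p) a + J (f p) b + J (f p) (J (f p) c)"
    using T by (simp add: abc(4) J_add J_in_tangent_space subspace_add[OF subspace_tangent_space])
  also have "\<dots> = J (f p) a + (- c) + J (f p) b"
    using T by (simp add: J_J)
  also have "\<dots> \<in> D p"
    using abc D0_fibre(2)[of p] subspace_neg[OF vector_subbundle_fibre(1)[OF D1_fibre(1)]]
    by (intro D_intro) auto
  finally show ?thesis .
qed

text \<open>This is the pointwise criterion behind the converse direction: \<open>J\<close> carries
  the complement of \<open>D\<close> in \<open>TM\<close> into \<open>tr\<close>, so a nonzero
  component there would make the image under \<open>J\<close> leave \<open>TM\<close>.\<close>

lemma D_if_J_tangent:
  assumes "v \<in> TM p" "J (f p) v \<in> TM p"
  shows "v \<in> D p"
proof -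
  obtain s k where sk: "s \<in> ST p" "k \<in> Rad p" "v = s + k"
    using assms(1) unfolding tangent_bundle_eq by (auto elim: set_plus_elim)
  obtain c d' a where s: "c \<in> D1 p" "d' \<in> Dp p" "a \<in> D0 p" "s = J (f p) c + d' + a"
    using sk(1) unfolding ST_eq by (auto elim!: set_plus_elim)
  obtain b d2 where k: "b \<in> D1 p" "d2 \<in> D2 p" "k = b + d2"
    using sk(2) unfolding Rad_eq by (auto elim!: set_plus_elim)
  \<comment> \<open>The screen and radical components are regrouped: \<open>d\<close> is the part in
    \<open>D\<close>, and \<open>e\<close> the part in \<open>Dp\<close> and
    \<open>D2\<close>.\<close>
  define d e where "d = a + b + J (f p) c" and "e = d' + d2"
  have vde: "v = d + e"
    by (simp add: d_def e_def sk s k algebra_simps)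
  have dD: "d \<in> D p"
    unfolding d_def using s k by (intro D_intro)
  have T: "d \<in> T p" "d' \<in> T p" "d2 \<in> T p"
    using dD s k D_sub_TM[of p] TM_sub_T[of p] Dp_fibre[of p] D2_fibre(1)[of p]
      ST_fibre(2)[of p] Rad_fibre(2)[of p] by blast+
  then have eT: "e \<in> T p"
    unfolding e_def by (intro subspace_add[OF subspace_tangent_space])
  \<comment> \<open>Both pieces of \<open>J e\<close> are transversal: \<open>J\<close> maps
    \<open>Dp\<close> into \<open>L1 + S\<close>, inside \<open>ltr + STp\<close>, and
    \<open>D2\<close> into \<open>STp\<close>.\<close>
  have "J (f p) d' \<in> L1 p + S p"
    using s(2) J_Dp_eq[of p] by blast
  then have "J (f p) d' \<in> tr p"
    unfolding transversal_bundle_def using set_plus_mono2[OF L1_fibre S_fibre] by blast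
  moreover have "J (f p) d2 \<in> tr p"
    using k(2) D2_fibre(2)[of p] STp_sub_tr[of p] by blast
  ultimately have "J (f p) e \<in> tr p"
    unfolding e_def using T by (simp add: J_add subspace_add[OF subspace_tr])
  moreover have "J (f p) e = J (f p) v - J (f p) d"
    using T eT by (simp add: vde J_add)
  then have "J (f p) e \<in> TM p"
    using assms(2) J_D[OF dD] D_sub_TM[of p] by (auto intro: subspace_diff[OF subspace_TM])
  ultimately have "J (f p) e = 0"
    using TM_tr_disjoint by blast
  then have "e = 0"
    using J_J[OF eT] J_zero by simp
  then show ?thesis
    using dD vde by simp
qed

lemma D_sections_tangent: "X \<in> smooth_sections A f D \<Longrightarrow> X p \<in> TM p"
  using D_sub_TM by (auto simp: smooth_sections_def)

lemma J_section:
  assumes "Y \<in> smooth_sections A f D"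
  shows "(\<lambda>p. J (f p) (Y p)) \<in> smooth_sections A f D"
proof -
  have "section_along A f UNIV (\<lambda>p. J (f p) (Y p))"
    unfolding section_along_def
  proof (intro conjI ballI open_UNIV)
    fix p
    have "section_along A f UNIV Y"
      using assms by (simp add: smooth_sections_def)
    then obtain V U Y' where "open V" "p \<in> V" "f ` V \<subseteq> U" "vector_field A U Y'"
      "\<And>x. x \<in> V \<Longrightarrow> Y' (f x) = Y x"
      by (rule section_along_extension[of A f UNIV Y p]) auto
    then show "\<exists>V U Y'. open V \<and> p \<in> V \<and> V \<subseteq> UNIV \<and> f ` V \<subseteq> U \<and> vector_field A U Y' \<and>
        (\<forall>x\<in>V. J (f x) (Y x) = Y' (f x))"
      using J_vector_field[of U Y'] by (intro exI[of _ V] exI[of _ U] exI[of _ "\<lambda>x. J x (Y' x)"]) auto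
  qed
  then show ?thesis
    using assms J_D by (auto simp: smooth_sections_def)
qed

lemma cov_section:
  assumes "X \<in> smooth_sections A f D" "Y \<in> smooth_sections A f D"
  shows "section_along A f UNIV (cov_along A f nabla X Y)"
  using assms
  by (intro section_along_cov_along D_sections_tangent) (auto simp: smooth_sections_def)

text \<open>If \<open>Y'\<close> extends \<open>Y\<close>, then applying \<open>J\<close> to
  \<open>Y'\<close> gives an extension of \<open>J Y\<close>. Parallelism of \<open>J\<close> on the
  ambient manifold therefore transfers to derivatives along \<open>f\<close>. Invariance of
  \<open>D\<close> keeps \<open>J Y\<close> tangent, as \<open>cov_along_eq\<close>
  requires.\<close>

lemma cov_J:
  assumes "X \<in> smooth_sections A f D" "Y \<in> smooth_sections A f D"
  shows "cov_along A f nabla X (\<lambda>x. J (f x) (Y x)) p = J (f p) (cov_along A f nabla X Y p)"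
proof -
  note tangent = D_sections_tangent[OF assms(1)] D_sections_tangent[OF assms(2)]
    D_sections_tangent[OF J_section[OF assms(2)]]
  have "section_along A f UNIV X" "section_along A f UNIV Y"
    using assms by (auto simp: smooth_sections_def)
  then obtain V U X' Y' where ext: "open V" "p \<in> V" "f ` V \<subseteq> U" "vector_field A U X'"
    "vector_field A U Y'" "\<And>x. x \<in> V \<Longrightarrow> X' (f x) = X x" "\<And>x. x \<in> V \<Longrightarrow> Y' (f x) = Y x"
    by (rule common_extension[of X Y p]) blast
  have "cov_along A f nabla X (\<lambda>x. J (f x) (Y x)) p = nabla X' (\<lambda>x. J x (Y' x)) (f p)"
    by (rule cov_along_eq[OF ext(1-4) J_vector_field[OF ext(5)] ext(6)]) (use ext(7) tangent in auto)
  also have "\<dots> = J (f p) (nabla X' Y' (f p))"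
    using kaehler ext(2-5) unfolding indefinite_kaehler_manifold_def by blast
  also have "nabla X' Y' (f p) = cov_along A f nabla X Y p"
    using cov_along_eq[OF ext tangent(1,2)] by simp
  finally show ?thesis .
qed

text \<open>The derivative of sections of \<open>D\<close> is a section along \<open>f\<close>, so
  its values lie in the ambient tangent space and the Gauss decomposition applies.\<close>

lemma geodesic_iff:
  "geodesic_wrt A nabla B f (transversal_bundle STp ltr) D \<longleftrightarrow>
     (\<forall>X\<in>smooth_sections A f D. \<forall>Y\<in>smooth_sections A f D. \<forall>p. cov_along A f nabla X Y p \<in> TM p)"
  unfolding geodesic_wrt_def
  using second_fundamental_form_eq_0_iff section_along_in_tangent_space[OF cov_section] by simp

lemma totally_geodesic_foliation_iff_geodesic:
  "totally_geodesic_foliation A nabla f D \<longleftrightarrow>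
     geodesic_wrt A nabla B f (transversal_bundle STp ltr) D"
proof
  assume "totally_geodesic_foliation A nabla f D"
  then show "geodesic_wrt A nabla B f (transversal_bundle STp ltr) D"
    using D_sections_tangent unfolding geodesic_iff totally_geodesic_foliation_def by blast
next
  assume "geodesic_wrt A nabla B f (transversal_bundle STp ltr) D"
  then have TM: "cov_along A f nabla X Y p \<in> TM p"
    if "X \<in> smooth_sections A f D" "Y \<in> smooth_sections A f D" for X Y p
    using that unfolding geodesic_iff by blast
  \<comment> \<open>The geodesic hypothesis is used twice, for \<open>Y\<close> and for
    \<open>J Y\<close>; \<open>cov_J\<close> turns the second use into tangency of \<open>J\<close>
    applied to the derivative.\<close>
  have "cov_along A f nabla X Y p \<in> D p"
    if XY: "X \<in> smooth_sections A f D" "Y \<in> smooth_sections A f D" for X Y p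
    using TM[OF XY] TM[OF XY(1) J_section[OF XY(2)]] cov_J[OF XY]
    by (intro D_if_J_tangent) simp_all
  then show "totally_geodesic_foliation A nabla f D"
    unfolding totally_geodesic_foliation_def
    using cov_section by (auto simp: smooth_sections_def)
qed

end

theorem theorem3p8:
  fixes A :: "('a::{t2_space,second_countable_topology}, 'e::euclidean_space) atlas"
    and B :: "('b::{t2_space,second_countable_topology}, 'd::euclidean_space) atlas"
    and g :: "'a \<Rightarrow> 'a tvec \<Rightarrow> 'a tvec \<Rightarrow> real"
    and J :: "'a \<Rightarrow> 'a tvec \<Rightarrow> 'a tvec"
    and nabla :: "('a \<Rightarrow> 'a tvec) \<Rightarrow> ('a \<Rightarrow> 'a tvec) \<Rightarrow> 'a \<Rightarrow> 'a tvec"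
    and f :: "'b \<Rightarrow> 'a"
    and q r :: nat
    and ST STp ltr D0 D1 D2 Dp L1 L2 S :: "'b \<Rightarrow> 'a tvec set"
  assumes "indefinite_kaehler_manifold A q g J nabla"
    and "stcr_lightlike_submanifold A g J B f r ST STp ltr D0 D1 D2 Dp L1 L2 S"
  shows "totally_geodesic_foliation A nabla f (stcr_distribution J f D0 D1) \<longleftrightarrow>
         geodesic_wrt A nabla B f (transversal_bundle STp ltr) (stcr_distribution J f D0 D1)"
proof -
  interpret kaehler_stcr A B g J nabla f q r ST STp ltr D0 D1 D2 Dp L1 L2 S
    by (rule kaehler_stcr.intro[OF assms])
  show ?thesis
    by (rule totally_geodesic_foliation_iff_geodesic)
qed

end
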